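(* Let $n\ge 1$. For $\boldsymbol{\alpha}=(\alpha_1,\dots,\alpha_n)\in(0,1]^n$, $\boldsymbol{\nu}=(\nu_1,\dots,\nu_n)\in(0,\infty)^n$ and a representation $(\boldsymbol{\pi},\boldsymbol{T},\boldsymbol{R})$, let $\mathrm{GMML}(\boldsymbol{\alpha},\boldsymbol{\pi},\boldsymbol{T},\boldsymbol{R})$ and $\mathrm{GMML}^{1/\boldsymbol{\nu}}(\boldsymbol{\alpha},\boldsymbol{\pi},\boldsymbol{T},\boldsymbol{R})$ be the distributions on $\mathbb{R}_+^n$ defined in the context. Then: (i) The class of all distributions $\mathrm{GMML}(\boldsymbol{\alpha},\boldsymbol{\pi},\boldsymbol{T},\boldsymbol{R})$ (with $\boldsymbol{\alpha}\in(0,1]^n$ and all representations $(\boldsymbol{\pi},\boldsymbol{T},\boldsymbol{R})$) is dense on $\mathbb{R}_+^n$. (ii) For any fixed $\boldsymbol{\alpha}\in(0,1]^n$, the class of all distributions $\mathrm{GMML}^{1/\boldsymbol{\nu}}(\boldsymbol{\alpha},\boldsymbol{\pi},\boldsymbol{T},\boldsymbol{R})$ (with $\boldsymbol{\nu}\in(0,\infty)^n$ and all representations $(\boldsymbol{\pi},\boldsymbol{T},\boldsymbol{R})$) is dense on $\mathbb{R}_+^n$. (iii) For any fixed vector $\boldsymbol{\gamma}=(\gamma_1,\dots,\gamma_n)\in(0,\infty)^n$, the class of all distributions $\mathrm{GMML}^{1/\boldsymbol{\nu}}(\boldsymbol{\alpha},\boldsymbol{\pi},\boldsymbol{T},\boldsymbol{R})$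 with $\boldsymbol{\alpha}\in(0,1]^n$, $\boldsymbol{\nu}\in(0,\infty)^n$ satisfying $\alpha_i\nu_i=\gamma_i^{-1}$ for all $i=1,\dots,n$ (and all representations $(\boldsymbol{\pi},\boldsymbol{T},\boldsymbol{R})$) is dense on $\mathbb{R}_+^n$.
   Context: $\mathbb{R}_+=[0,\infty)$. A class of distributions is called dense on $\mathbb{R}_+^n$ if it is dense, in the sense of weak convergence, among all probability distributions on $\mathbb{R}_+^n$. A phase-type representation $(\boldsymbol{\pi},\boldsymbol{T})$ of dimension $p$ consists of a probability row vector $\boldsymbol{\pi}=(\pi_1,\dots,\pi_p)$ and a $p\times p$ sub-intensity matrix $\boldsymbol{T}$, i.e. the restriction to the transient states $1,\dots,p$ of the intensity matrix of a Markov jump process on $\{1,\dots,p,p+1\}$ in which $1,\dots,p$ are transient and $p+1$ is absorbing (off-diagonal entries nonnegative, row sums nonpositive, $\boldsymbol{T}$ invertible). Put $\boldsymbol{t}=-\boldsymbol{T}\boldsymbol{e}$, where $\boldsymbol{e}$ is the column vector of ones. A representation $(\boldsymbol{\pi},\boldsymbol{T},\boldsymbol{R})$ consists of a phase-type representation of some (arbitrary finite) dimension $p$ together with a $p\times n$ matrix $\boldsymbol{R}$ with nonnegative entries. $\boldsymbol{\Delta}(\boldsymbol{a})$ denotes the diagonal matrix with the vector $\boldsymbol{a}$ on the diagonal. For $\boldsymbol{\alpha}\in(0,1]^n$, a random vector $\boldsymbol{X}=(X_1,\dots,X_n)$ in $\mathbb{R}_+^n$ has distribution $\mathrm{GMML}(\boldsymbol{\alpha},\boldsymbol{\pi},\boldsymbol{T},\boldsymbol{R})$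 if $$\mathbb{E}\big(e^{-\langle \boldsymbol{u},\boldsymbol{X}\rangle}\big)=\boldsymbol{\pi}\left(\boldsymbol{\Delta}(\boldsymbol{R}\boldsymbol{u}^{\boldsymbol{\alpha}})-\boldsymbol{T}\right)^{-1}\boldsymbol{t},\qquad \boldsymbol{u}\in\mathbb{R}_+^n,$$ where $\boldsymbol{u}^{\boldsymbol{\alpha}}=(u_1^{\alpha_1},\dots,u_n^{\alpha_n})$ (regarded as a column vector). Such a random vector exists for every such choice of parameters. For $\boldsymbol{\nu}\in(0,\infty)^n$, $\mathrm{GMML}^{1/\boldsymbol{\nu}}(\boldsymbol{\alpha},\boldsymbol{\pi},\boldsymbol{T},\boldsymbol{R})$ is the distribution of $\boldsymbol{X}^{1/\boldsymbol{\nu}}=(X_1^{1/\nu_1},\dots,X_n^{1/\nu_n})$ where $\boldsymbol{X}\sim\mathrm{GMML}(\boldsymbol{\alpha},\boldsymbol{\pi},\boldsymbol{T},\boldsymbol{R})$. *)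

theory Defs
  imports
    "HOL-Probability.Probability"
    "Jordan_Normal_Form.Gauss_Jordan_Elimination"
begin

text \<open>
  Points of n-space have type \<^typ>\<open>real^'n\<close>. The phase dimension \<open>p\<close> ranges over all natural
  numbers inside the statement, so phase-type vectors and matrices have the types of
  \<^theory>\<open>Jordan_Normal_Form.Matrix\<close>, with indices \<open>0..<p\<close>. The infix symbols for component access
  and inner product below are those of HOL-Analysis.
\<close>

no_notation Matrix.vec_index (infixl \<open>$\<close> 100)
no_notation Matrix.scalar_prod (infix \<open>\<bullet>\<close> 70)

definition nonneg_vec :: "real^'n \<Rightarrow> bool" where
  "nonneg_vec x \<longleftrightarrow> (\<forall>i. 0 \<le> x $ i)"

definition pos_vec :: "real^'n \<Rightarrow> bool" where
  "pos_vec x \<longleftrightarrow> (\<forall>i. 0 < x $ i)"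

definition unit_exponents :: "real^'n \<Rightarrow> bool" where
  "unit_exponents a \<longleftrightarrow> (\<forall>i. 0 < a $ i \<and> a $ i \<le> 1)"

text \<open>
  In HOL \<^prop>\<open>(0::real) powr a = 0\<close> for all \<open>a\<close>; the function below is only used for
  nonnegative \<open>x\<close> and positive exponents, where this is the usual power.
\<close>

definition vpowr :: "real^'n \<Rightarrow> real^'n \<Rightarrow> real^'n" where
  "vpowr x a = (\<chi> i. x $ i powr a $ i)"

definition orthant_law :: "(real^'n) measure \<Rightarrow> bool" where
  "orthant_law M \<longleftrightarrow> prob_space M \<and> sets M = sets borel \<and> (AE x in M. nonneg_vec x)"

text \<open>
  Test functions are bounded and continuous on the whole space. As the nonnegative orthant is closed,
  they restrict to all bounded continuous functions on the orthant (Tietze), so for laws carried by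
  the orthant this is weak convergence of distributions on the orthant.
\<close>

definition weak_conv_to :: "(nat \<Rightarrow> (real^'n) measure) \<Rightarrow> (real^'n) measure \<Rightarrow> bool" where
  "weak_conv_to Ms M \<longleftrightarrow>
     (\<forall>f :: real^'n \<Rightarrow> real. continuous_on UNIV f \<and> bounded (range f) \<longrightarrow>
        (\<lambda>k. \<integral>x. f x \<partial>(Ms k)) \<longlonglongrightarrow> (\<integral>x. f x \<partial>M))"

definition dense_on_orthant :: "(real^'n) measure set \<Rightarrow> bool" where
  "dense_on_orthant C \<longleftrightarrow>
     C \<subseteq> Collect orthant_law \<and>
     (\<forall>M. orthant_law M \<longrightarrow> (\<exists>Ms. (\<forall>k. Ms k \<in> C) \<and> weak_conv_to Ms M))"

definition sub_intensity :: "nat \<Rightarrow> real mat \<Rightarrow> bool" where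
  "sub_intensity p T \<longleftrightarrow>
     T \<in> carrier_mat p p \<and>
     (\<forall>i<p. \<forall>j<p. i \<noteq> j \<longrightarrow> 0 \<le> T $$ (i, j)) \<and>
     (\<forall>i<p. (\<Sum>j<p. T $$ (i, j)) \<le> 0) \<and>
     invertible_mat T"

definition phase_type_rep :: "nat \<Rightarrow> real Matrix.vec \<Rightarrow> real mat \<Rightarrow> bool" where
  "phase_type_rep p \<pi> T \<longleftrightarrow>
     \<pi> \<in> carrier_vec p \<and>
     (\<forall>i<p. 0 \<le> vec_index \<pi> i) \<and>
     (\<Sum>i<p. vec_index \<pi> i) = 1 \<and>
     sub_intensity p T"

text \<open>
  The reward matrix is given by its rows: \<open>R i $ j\<close> is the entry in row \<open>i < p\<close> and column \<open>j\<close>;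
  the values \<open>R i\<close> with \<open>p \<le> i\<close> are never used.
\<close>

definition reward_rep :: "nat \<Rightarrow> real Matrix.vec \<Rightarrow> real mat \<Rightarrow> (nat \<Rightarrow> real^'n) \<Rightarrow> bool" where
  "reward_rep p \<pi> T R \<longleftrightarrow> phase_type_rep p \<pi> T \<and> (\<forall>i<p. nonneg_vec (R i))"

definition exit_vec :: "nat \<Rightarrow> real mat \<Rightarrow> real Matrix.vec" where
  "exit_vec p T = - (T *\<^sub>v Matrix.vec p (\<lambda>_. 1))"

text \<open>
  The matrix that is inverted here has an inverse whenever \<open>(\<pi>, T, R)\<close> is a representation and
  \<open>u\<close> is nonnegative, so \<^const>\<open>the\<close> is applied to a proper value. The inner product
  \<open>R i \<bullet> vpowr u \<alpha>\<close> is component \<open>i\<close> of the matrix-vector product of \<open>R\<close> with \<open>vpowr u \<alpha>\<close>.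
\<close>

definition gmml_transform ::
    "real^'n \<Rightarrow> nat \<Rightarrow> real Matrix.vec \<Rightarrow> real mat \<Rightarrow> (nat \<Rightarrow> real^'n) \<Rightarrow> real^'n \<Rightarrow> real" where
  "gmml_transform \<alpha> p \<pi> T R u =
     scalar_prod \<pi>
       (the (mat_inverse (mat_diag p (\<lambda>i. R i \<bullet> vpowr u \<alpha>) - T)) *\<^sub>v exit_vec p T)"

definition is_GMML ::
    "real^'n \<Rightarrow> nat \<Rightarrow> real Matrix.vec \<Rightarrow> real mat \<Rightarrow> (nat \<Rightarrow> real^'n) \<Rightarrow> (real^'n) measure \<Rightarrow> bool" where
  "is_GMML \<alpha> p \<pi> T R M \<longleftrightarrow>
     orthant_law M \<and>
     (\<forall>u. nonneg_vec u \<longrightarrow> (\<integral>x. exp (- (u \<bullet> x)) \<partial>M) = gmml_transform \<alpha> p \<pi> T R u)"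

definition is_GMML_pow ::
    "real^'n \<Rightarrow> real^'n \<Rightarrow> nat \<Rightarrow> real Matrix.vec \<Rightarrow> real mat \<Rightarrow> (nat \<Rightarrow> real^'n) \<Rightarrow>
     (real^'n) measure \<Rightarrow> bool" where
  "is_GMML_pow \<nu> \<alpha> p \<pi> T R N \<longleftrightarrow>
     (\<exists>M. is_GMML \<alpha> p \<pi> T R M \<and> N = distr M borel (\<lambda>x. vpowr x (\<chi> i. 1 / \<nu> $ i)))"

end

theory Submission
  imports Defs "Jordan_Normal_Form.Determinant" "HOL-Real_Asymp.Real_Asymp"
begin

no_notation Matrix.vec_index (infixl \<open>$\<close> 100)
no_notation Matrix.scalar_prod (infix \<open>\<bullet>\<close> 70)

text \<open>
  Products and powers of vectors are meant componentwise. Let \<open>X\<close> have the target law.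
  Choose simple functions \<open>d\<^sub>k\<close> with \<open>d\<^sub>k(x) \<rightarrow> x\<close> and values in the orthant, and, independent of
  \<open>X\<close>, vectors \<open>Z\<^sub>k\<close> with Laplace transform \<open>\<Prod>l<L. 1 / (1 + \<langle>s\<^sub>l, u\<^sup>\<alpha>\<rangle>)\<close>. Such a transform is
  represented by \<open>L\<close> phases of rate one that are visited in a fixed order, with reward rows \<open>s\<^sub>l\<close>. Scaling
  \<open>Z\<^sub>k\<close> by a vector \<open>c\<close> multiplies the reward rows by \<open>c\<^sup>\<alpha>\<close>, and a finite mixture of such laws arises
  when several of these chains of phases are put side by side and the initial vector chooses among
  them. As \<open>d\<^sub>k\<close> has finitely many values, \<open>d\<^sub>k(X)\<^sup>\<nu> Z\<^sub>k\<close> is therefore a GMML vector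
  (\<open>gmml_transform_chains\<close>, \<open>GMML_of_scaled_chain\<close>). Its power with exponent \<open>1/\<nu>\<close> is
  \<open>d\<^sub>k(X) Z\<^sub>k\<^sup>1\<^sup>/\<^sup>\<nu>\<close>, which converges weakly to \<open>X\<close> as soon as \<open>Z\<^sub>k\<^sup>1\<^sup>/\<^sup>\<nu> \<rightarrow> 1\<close> in probability
  (\<open>GMML_pow_approximation\<close>); the exponent \<open>\<nu>\<close> may vary with \<open>k\<close>. Discretisation and concentration
  happen along the same index, so no diagonal sequence has to be extracted.

  It remains to choose \<open>Z\<^sub>k\<close> and \<open>\<nu>\<close>. If \<open>\<alpha>\<close> may be chosen, take \<open>\<alpha> = 1\<close> and let all coordinates
  of \<open>Z\<^sub>k\<close> be one Erlang variable with mean \<open>1\<close> and variance \<open>1/(k+1)\<close>; then every fixed power of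
  \<open>Z\<^sub>k\<close> concentrates at \<open>1\<close>, and \<open>\<nu> = 1/\<gamma>\<close> gives the third class, \<open>\<nu> = 1\<close> the first one.
  If \<open>\<alpha>\<close> is prescribed, take one strictly positive \<open>Z\<close> and let all \<open>\<nu>\<^sub>i = k+1\<close> grow: roots of
  increasing order of any positive number tend to \<open>1\<close>. A suitable \<open>Z\<close> has independent
  Mittag-Leffler coordinates, with Laplace transforms \<open>1 / (1 + t\<^sup>a)\<close>.

  The existence of the Mittag-Leffler law (\<open>mittag_leffler_law\<close>) is obtained from lattice laws. The
  function \<open>1 / (1 + c (1 - z)\<^sup>a)\<close> is a probability generating function: its coefficients satisfy a
  renewal recursion with nonnegative weights. For \<open>c = N\<^sup>a\<close> and lattice width \<open>1/N\<close> the Laplace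
  transforms converge to \<open>1 / (1 + t\<^sup>a)\<close>, and Helly's theorem yields the limit law.
\<close>

section \<open>Phase-type representations made of parallel chains\<close>

text \<open>
  Invertibility comes from the determinant, the product of the diagonal. The second part evaluates the
  resolvent in a transform without computing an inverse: it suffices to guess the solution of the
  linear system.
\<close>
lemma upper_triangular_solve:
  fixes A :: "'a::field mat"
  assumes A: "A \<in> carrier_mat n n" and tri: "upper_triangular A"
    and diag: "\<And>i. i < n \<Longrightarrow> A $$ (i, i) \<noteq> 0"
  shows "invertible_mat A"
    and "\<lbrakk>x \<in> carrier_vec n; A *\<^sub>v x = b\<rbrakk> \<Longrightarrow> the (mat_inverse A) *\<^sub>v b = x"
proof -
  have "det A \<noteq> 0"
    using A diag by (auto simp: det_upper_triangular[OF tri A] diag_mat_def)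
  then have "A \<in> Units (ring_mat TYPE('a) n ())"
    by (rule det_non_zero_imp_unit[OF A])
  then obtain B where "mat_inverse A = Some B"
    using mat_inverse(1)[OF A, where b = "()"] by (cases "mat_inverse A") auto
  then have B: "the (mat_inverse A) = B" "A * B = 1\<^sub>m n" "B * A = 1\<^sub>m n" "B \<in> carrier_mat n n"
    using mat_inverse(2)[OF A] by auto
  show "invertible_mat A"
    unfolding invertible_mat_def inverts_mat_def using A B by auto
  show "the (mat_inverse A) *\<^sub>v b = x" if x: "x \<in> carrier_vec n" and b: "A *\<^sub>v x = b"
  proof -
    have "B *\<^sub>v b = (B * A) *\<^sub>v x"
      using A B(4) x b by (simp add: assoc_mult_mat_vec)
    then show ?thesis using B(1,3) x by simp
  qed
qed

text \<open>
  \<open>K\<close> chains with \<open>L\<close> states each. State \<open>k * L + l\<close> is place \<open>l\<close> of chain \<open>k\<close>; every state is left at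
  rate one, for the next place of its chain or, from the last place, by absorption.
\<close>
definition chains_subint :: "nat \<Rightarrow> nat \<Rightarrow> real mat" where
  "chains_subint K L = mat (K * L) (K * L)
     (\<lambda>(i, j). if j = i then - 1 else if j = Suc i \<and> \<not> L dvd j then 1 else 0)"

lemma chains_subint_carrier: "chains_subint K L \<in> carrier_mat (K * L) (K * L)"
  by (simp add: chains_subint_def)

lemma chains_subint_mult_vec:
  assumes i: "i < K * L"
  shows "vec_index (chains_subint K L *\<^sub>v Matrix.vec (K * L) x) i =
           (if L dvd Suc i then 0 else x (Suc i)) - x i"
proof -
  have lt: "Suc i < K * L" if "\<not> L dvd Suc i"
    using i that by (metis Suc_lessI dvd_triv_right)
  have "vec_index (chains_subint K L *\<^sub>v Matrix.vec (K * L) x) i =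
      (\<Sum>j<K * L. (if j = i then - 1 else if j = Suc i \<and> \<not> L dvd j then 1 else 0) * x j)"
    using i by (simp add: chains_subint_def scalar_prod_def row_def atLeast0LessThan)
  also have "\<dots> = (\<Sum>j<K * L. (if j = i then - x i else 0) +
      (if j = Suc i then (if L dvd Suc i then 0 else x (Suc i)) else 0))"
    by (intro sum.cong) auto
  also have "\<dots> = (if L dvd Suc i then 0 else x (Suc i)) - x i"
    using i lt by (auto simp: sum.distrib)
  finally show ?thesis .
qed

lemma chains_subint_row_sum:
  assumes i: "i < K * L"
  shows "(\<Sum>j<K * L. chains_subint K L $$ (i, j)) = (if L dvd Suc i then - 1 else 0)"
proof -
  have "(\<Sum>j<K * L. chains_subint K L $$ (i, j)) =
      vec_index (chains_subint K L *\<^sub>v Matrix.vec (K * L) (\<lambda>_. 1)) i"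
    using i by (simp add: chains_subint_def scalar_prod_def row_def atLeast0LessThan)
  then show ?thesis using chains_subint_mult_vec[OF i] by auto
qed

lemma sub_intensity_chains: "sub_intensity (K * L) (chains_subint K L)"
  unfolding sub_intensity_def
proof (intro conjI)
  show "invertible_mat (chains_subint K L)"
    by (rule upper_triangular_solve(1)[OF chains_subint_carrier])
       (auto simp: chains_subint_def)
qed (auto simp: chains_subint_carrier chains_subint_row_sum, auto simp: chains_subint_def)

definition chains_start :: "nat \<Rightarrow> nat \<Rightarrow> (nat \<Rightarrow> real) \<Rightarrow> real Matrix.vec" where
  "chains_start K L w = Matrix.vec (K * L) (\<lambda>i. if L dvd i then w (i div L) else 0)"

lemma chains_start_sum:
  assumes L: "0 < L"
  shows "(\<Sum>i<K * L. vec_index (chains_start K L w) i * x i) = (\<Sum>k<K. w k * x (k * L))"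
proof -
  have "(\<Sum>i<K * L. vec_index (chains_start K L w) i * x i) =
      (\<Sum>i<K * L. (if L dvd i then w (i div L) else 0) * x i)"
    by (simp add: chains_start_def)
  also have "\<dots> = (\<Sum>k<K. \<Sum>i\<in>{k * L..<k * L + L}. (if L dvd i then w (i div L) else 0) * x i)"
    by (rule sum.nat_group[symmetric])
  also have "\<dots> = (\<Sum>k<K. \<Sum>i\<in>{k * L}. w k * x (k * L))"
  proof (rule sum.cong[OF refl], rule sum.mono_neutral_cong_right, goal_cases)
    case (3 k)
    show ?case
    proof
      fix i assume "i \<in> {k * L..<k * L + L} - {k * L}"
      then obtain d where "i = k * L + d" "0 < d" "d < L"
        by (intro that[of "i - k * L"]) auto
      then have "\<not> L dvd i"
        by (metis dvd_add_right_iff dvd_triv_right nat_dvd_not_less)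
      then show "(if L dvd i then w (i div L) else 0) * x i = 0" by simp
    qed
  qed (use L in auto)
  finally show ?thesis by simp
qed

text \<open>
  A path that starts in chain \<open>k\<close> passes through all places of that chain, and the independent unit
  exponential holding time at place \<open>l\<close>, weighted with the reward \<open>r k l\<close>, contributes the factor
  \<open>1 / (1 + r k l \<bullet> vpowr u \<alpha>)\<close>.
\<close>
lemma gmml_transform_chains:
  fixes \<alpha> u :: "real^'n"
  assumes L: "0 < L" and r: "\<And>k l. k < K \<Longrightarrow> l < L \<Longrightarrow> nonneg_vec (r k l)"
  shows "gmml_transform \<alpha> (K * L) (chains_start K L w) (chains_subint K L)
            (\<lambda>i. r (i div L) (i mod L)) u =
         (\<Sum>k<K. w k * (\<Prod>l<L. 1 / (1 + r k l \<bullet> vpowr u \<alpha>)))"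
proof -
  define \<rho> where "\<rho> i = r (i div L) (i mod L) \<bullet> vpowr u \<alpha>" for i
  have \<rho>: "0 \<le> \<rho> i" if "i < K * L" for i
  proof -
    have "i div L < K" "i mod L < L" using that L by (auto simp: less_mult_imp_div_less)
    then show ?thesis unfolding \<rho>_def using r[of "i div L" "i mod L"]
      by (auto simp: inner_vec_def nonneg_vec_def vpowr_def intro!: sum_nonneg)
  qed
  \<comment> \<open>the Laplace transform at \<open>vpowr u \<alpha>\<close> of the reward collected after starting in state \<open>i\<close>\<close>
  define x where "x i = (\<Prod>l\<in>{i mod L..<L}. 1 / (1 + r (i div L) l \<bullet> vpowr u \<alpha>))" for i
  define A where "A = mat_diag (K * L) \<rho> - chains_subint K L"
  have A: "A \<in> carrier_mat (K * L) (K * L)"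
    unfolding A_def by (intro minus_carrier_mat chains_subint_carrier)
  have step: "(1 + \<rho> i) * x i = (if L dvd Suc i then 1 else x (Suc i))" if "i < K * L" for i
  proof -
    have lt: "i mod L < L" using L by simp
    have "x i = 1 / (1 + \<rho> i) *
        (\<Prod>l\<in>{Suc (i mod L)..<L}. 1 / (1 + r (i div L) l \<bullet> vpowr u \<alpha>))"
      unfolding x_def \<rho>_def using lt by (subst prod.atLeast_Suc_lessThan) auto
    moreover have "1 + \<rho> i > 0" using \<rho>[OF that] by linarith
    moreover have "(\<Prod>l\<in>{Suc (i mod L)..<L}. 1 / (1 + r (i div L) l \<bullet> vpowr u \<alpha>)) =
        (if L dvd Suc i then 1 else x (Suc i))"
    proof (cases "L dvd Suc i")
      case True
      then have "Suc (i mod L) = L" using lt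
        by (metis dvd_imp_mod_0 mod_Suc nat.distinct(1))
      then show ?thesis using True by simp
    next
      case False
      then have "Suc i mod L = Suc (i mod L)" "Suc i div L = i div L"
        by (auto simp: mod_Suc div_Suc dvd_eq_mod_eq_0 split: if_splits)
      then show ?thesis using False by (simp add: x_def)
    qed
    ultimately show ?thesis by simp
  qed
  have solve: "A *\<^sub>v Matrix.vec (K * L) x = exit_vec (K * L) (chains_subint K L)"
  proof (rule eq_vecI)
    show "dim_vec (A *\<^sub>v Matrix.vec (K * L) x) = dim_vec (exit_vec (K * L) (chains_subint K L))"
      using A chains_subint_carrier[of K L] by (simp add: exit_vec_def)
    fix i assume "i < dim_vec (exit_vec (K * L) (chains_subint K L))"
    then have i: "i < K * L" using chains_subint_carrier[of K L] by (simp add: exit_vec_def)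
    have D: "vec_index (mat_diag (K * L) \<rho> *\<^sub>v Matrix.vec (K * L) x) i = \<rho> i * x i"
    proof -
      have "vec_index (mat_diag (K * L) \<rho> *\<^sub>v Matrix.vec (K * L) x) i =
         (\<Sum>j<K * L. (if i = j then \<rho> j else 0) * x j)"
        using i by (simp add: mat_diag_def scalar_prod_def row_def atLeast0LessThan)
      also have "\<dots> = (\<Sum>j<K * L. (if j = i then \<rho> i * x i else 0))"
        by (intro sum.cong) auto
      finally show ?thesis using i by simp
    qed
    have "A *\<^sub>v Matrix.vec (K * L) x = mat_diag (K * L) \<rho> *\<^sub>v Matrix.vec (K * L) x
        - chains_subint K L *\<^sub>v Matrix.vec (K * L) x"
      unfolding A_def
      by (rule minus_mult_distrib_mat_vec[OF _ chains_subint_carrier]) auto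
    then have "vec_index (A *\<^sub>v Matrix.vec (K * L) x) i =
        \<rho> i * x i - ((if L dvd Suc i then 0 else x (Suc i)) - x i)"
      using i D chains_subint_mult_vec[OF i, of x] chains_subint_carrier[of K L] by simp
    also have "\<dots> = (if L dvd Suc i then 1 else 0)"
      using step[OF i] by (auto simp: algebra_simps split: if_splits)
    also have "\<dots> = vec_index (exit_vec (K * L) (chains_subint K L)) i"
      using i chains_subint_mult_vec[OF i, of "\<lambda>_. 1"] chains_subint_carrier[of K L]
      by (simp add: exit_vec_def)
    finally show "vec_index (A *\<^sub>v Matrix.vec (K * L) x) i =
        vec_index (exit_vec (K * L) (chains_subint K L)) i" .
  qed
  have "the (mat_inverse A) *\<^sub>v exit_vec (K * L) (chains_subint K L) = Matrix.vec (K * L) x"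
  proof (rule upper_triangular_solve(2)[OF A _ _ _ solve])
    show "A $$ (i, i) \<noteq> 0" if "i < K * L" for i
      using that \<rho>[OF that] by (simp add: A_def mat_diag_def chains_subint_def)
  qed (auto simp: A_def mat_diag_def chains_subint_def)
  then have "gmml_transform \<alpha> (K * L) (chains_start K L w) (chains_subint K L)
      (\<lambda>i. r (i div L) (i mod L)) u = scalar_prod (chains_start K L w) (Matrix.vec (K * L) x)"
    by (simp add: gmml_transform_def A_def \<rho>_def[abs_def])
  also have "\<dots> = (\<Sum>i<K * L. vec_index (chains_start K L w) i * x i)"
    by (simp add: scalar_prod_def atLeast0LessThan)
  also have "\<dots> = (\<Sum>k<K. w k * x (k * L))"
    by (rule chains_start_sum[OF L])
  also have "\<dots> = (\<Sum>k<K. w k * (\<Prod>l<L. 1 / (1 + r k l \<bullet> vpowr u \<alpha>)))"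
    using L by (simp add: x_def atLeast0LessThan)
  finally show ?thesis .
qed

lemma reward_rep_chains:
  fixes r :: "nat \<Rightarrow> nat \<Rightarrow> real^'n"
  assumes L: "0 < L" and r: "\<And>k l. k < K \<Longrightarrow> l < L \<Longrightarrow> nonneg_vec (r k l)"
    and w: "\<And>k. k < K \<Longrightarrow> 0 \<le> w k" "(\<Sum>k<K. w k) = 1"
  shows "reward_rep (K * L) (chains_start K L w) (chains_subint K L) (\<lambda>i. r (i div L) (i mod L))"
proof -
  have "(\<Sum>i<K * L. vec_index (chains_start K L w) i) = 1"
    using chains_start_sum[OF L, of K w "\<lambda>_. 1"] w by simp
  moreover have "i div L < K" if "i < K * L" for i
    using that by (simp add: less_mult_imp_div_less)
  ultimately show ?thesis
    using r w L unfolding reward_rep_def phase_type_rep_def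
    by (auto simp: sub_intensity_chains chains_start_def)
qed

section \<open>The one-dimensional Mittag-Leffler law\<close>

text \<open>
  The Taylor coefficients of \<open>(1 - z)\<^sup>a\<close>.
\<close>
definition binom_coeff :: "real \<Rightarrow> nat \<Rightarrow> real" where
  "binom_coeff a k = (-1) ^ k * (a gchoose k)"

lemma binom_coeff_0 [simp]: "binom_coeff a 0 = 1"
  by (simp add: binom_coeff_def)

lemma binom_coeff_Suc: "real (Suc k) * binom_coeff a (Suc k) = (real k - a) * binom_coeff a k"
proof -
  have "(- 1) ^ k * (a * (a gchoose k)) =
      (- 1) ^ k * (real k * (a gchoose k) + real (Suc k) * (a gchoose Suc k))"
    by (simp only: gbinomial_mult_1)
  then show ?thesis by (simp add: binom_coeff_def algebra_simps)
qed

lemma binom_coeff_sums: "\<bar>z\<bar> < 1 \<Longrightarrow> (\<lambda>k. binom_coeff a k * z ^ k) sums (1 - z) powr a"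
  using gen_binomial_real[of "- z" a]
  by (simp add: binom_coeff_def power_minus[of z] mult_ac)

lemma binom_coeff_nonneg: "a \<le> 0 \<Longrightarrow> 0 \<le> binom_coeff a k"
proof (induction k)
  case (Suc k)
  then have "0 \<le> real (Suc k) * binom_coeff a (Suc k)"
    unfolding binom_coeff_Suc by (intro mult_nonneg_nonneg) auto
  then show ?case by (simp add: zero_le_mult_iff)
qed simp

lemma binom_coeff_nonpos:
  assumes a: "0 < a" "a \<le> 1"
  shows "0 < k \<Longrightarrow> binom_coeff a k \<le> 0"
proof (induction k)
  case (Suc k)
  have "real (Suc k) * binom_coeff a (Suc k) \<le> 0"
  proof (cases "k = 0")
    case False
    then have "binom_coeff a k \<le> 0" "real k - a \<ge> 0" using Suc.IH a by auto
    then show ?thesis unfolding binom_coeff_Suc by (simp add: mult_nonneg_nonpos)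
  qed (use a in \<open>simp add: binom_coeff_def\<close>)
  then show ?case by (simp add: mult_le_0_iff)
qed simp

text \<open>
  The negated coefficients, without the constant term, are the weights of the Sibuya distribution. The
  bound rests on an explicit partial sum: the coefficients of \<open>(1 - z)\<^sup>a\<close> up to index \<open>n\<close> add up to
  coefficient number \<open>n\<close> of \<open>(1 - z)\<^sup>a / (1 - z)\<close>, which is nonnegative as \<open>a \<le> 1\<close>.
\<close>
lemma sum_neg_binom_coeff_le_1:
  assumes a: "0 < a" "a \<le> 1"
  shows "(\<Sum>k=1..n. - binom_coeff a k) \<le> 1"
proof -
  have "0 \<le> binom_coeff (a - 1) n" using a by (intro binom_coeff_nonneg) auto
  also have "\<dots> = (\<Sum>k\<le>n. binom_coeff a k)"
    using gbinomial_sum_lower_neg[of a n] by (simp add: binom_coeff_def mult.commute)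
  also have "\<dots> = 1 + (\<Sum>k=1..n. binom_coeff a k)"
    by (simp add: atMost_atLeast0 sum.atLeast_Suc_atMost)
  finally show ?thesis by (simp add: sum_negf)
qed

text \<open>
  The Taylor coefficients of \<open>1 / (1 + c (1 - z)\<^sup>a)\<close>, computed by comparing coefficients in
  \<open>(1 + c (1 - z)\<^sup>a) G(z) = 1\<close>. In this form all weights are nonnegative.
\<close>
fun renewal :: "real \<Rightarrow> real \<Rightarrow> nat \<Rightarrow> real" where
  "renewal a c n = (if n = 0 then 1 / (1 + c)
     else c / (1 + c) * (\<Sum>k=1..n. - binom_coeff a k * renewal a c (n - k)))"

declare renewal.simps [simp del]

lemma renewal_bounds:
  assumes a: "0 < a" "a \<le> 1" and c: "0 < c"
  shows "0 \<le> renewal a c n \<and> renewal a c n \<le> 1"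
proof (induction n rule: less_induct)
  case (less n)
  show ?case
  proof (cases "n = 0")
    case False
    have b: "0 \<le> - binom_coeff a k" if "k \<in> {1..n}" for k
      using binom_coeff_nonpos[OF a, of k] that by auto
    have IH: "0 \<le> renewal a c (n - k)" "renewal a c (n - k) \<le> 1" if "k \<in> {1..n}" for k
      using less.IH[of "n - k"] that by auto
    have "0 \<le> (\<Sum>k=1..n. - binom_coeff a k * renewal a c (n - k))"
      using b IH by (intro sum_nonneg mult_nonneg_nonneg)
    moreover have "(\<Sum>k=1..n. - binom_coeff a k * renewal a c (n - k)) \<le> (\<Sum>k=1..n. - binom_coeff a k)"
      using b IH by (intro sum_mono mult_left_le)
    moreover note sum_neg_binom_coeff_le_1[OF a, of n]
    ultimately have S: "0 \<le> S" "S \<le> 1"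
      if "S = (\<Sum>k=1..n. - binom_coeff a k * renewal a c (n - k))" for S
      unfolding that by auto
    have "0 \<le> c / (1 + c) * S" "c / (1 + c) * S \<le> 1"
      if "S = (\<Sum>k=1..n. - binom_coeff a k * renewal a c (n - k))" for S
      using S[OF that] c by (intro mult_nonneg_nonneg mult_le_one; simp)+
    then show ?thesis
      unfolding renewal.simps[of a c n] using False by presburger
  qed (use c in \<open>simp add: renewal.simps\<close>)
qed

text \<open>
  The recursion says that the Cauchy product with \<open>1 + c (1 - z)\<^sup>a\<close> is the constant series \<open>1\<close>; the
  binomial coefficients and the values of the recursion are bounded by one, so both series converge absolutely for \<open>\<bar>z\<bar> < 1\<close>.
\<close>
lemma renewal_sums:
  assumes a: "0 < a" "a \<le> 1" and c: "0 < c" and z: "0 \<le> z" "z < 1"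
  shows "(\<lambda>n. renewal a c n * z ^ n) sums (1 / (1 + c * (1 - z) powr a))"
proof -
  define f where "f k = ((if k = 0 then 1 else 0) + c * binom_coeff a k) * z ^ k" for k
  define g where "g k = renewal a c k * z ^ k" for k
  have zn: "\<bar>z\<bar> < 1" "norm z < 1" using z by auto
  have "(\<lambda>k. (if k = 0 then 1 else 0) + c * (binom_coeff a k * z ^ k)) sums (1 + c * (1 - z) powr a)"
    by (intro sums_add sums_mult binom_coeff_sums zn) (use sums_single[of 0 "\<lambda>_. 1::real"] in simp)
  also have "(\<lambda>k. (if k = 0 then 1 else 0) + c * (binom_coeff a k * z ^ k)) = f"
    by (auto simp: f_def fun_eq_iff algebra_simps)
  finally have F: "f sums (1 + c * (1 - z) powr a)" .
  have "\<bar>binom_coeff a k\<bar> \<le> 1" for k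
  proof (cases "k = 0")
    case False
    have "- binom_coeff a k \<le> (\<Sum>j=1..k. - binom_coeff a j)"
      by (rule member_le_sum) (use False binom_coeff_nonpos[OF a] in auto)
    then show ?thesis
      using sum_neg_binom_coeff_le_1[OF a, of k] binom_coeff_nonpos[OF a, of k] False by auto
  qed simp
  then have "\<bar>(if k = 0 then 1 else 0) + c * binom_coeff a k\<bar> \<le> 1 + c" for k
    using c mult_left_le[of "\<bar>binom_coeff a k\<bar>" c]
    by (intro order_trans[OF abs_triangle_ineq] add_mono) (auto simp: abs_mult)
  then have "norm (f k) \<le> (1 + c) * z ^ k" for k
    unfolding f_def real_norm_def abs_mult using z by (intro mult_mono) (auto simp: c less_imp_le)
  then have "summable (\<lambda>k. norm (f k))"
    using summable_mult[OF summable_geometric[OF zn(2)], of "1 + c"]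
    by (intro summable_comparison_test[where f = "\<lambda>k. norm (f k)" and g = "\<lambda>k. (1 + c) * z ^ k"])
       auto
  moreover have G: "summable (\<lambda>k. norm (g k))"
    using summable_geometric[OF zn(2)] renewal_bounds[OF a c] z
    by (intro summable_comparison_test[where f = "\<lambda>k. norm (g k)" and g = "\<lambda>k. z ^ k"])
       (auto simp: g_def abs_mult intro!: exI[of _ 0] mult_left_le_one_le)
  ultimately have "(\<lambda>k. \<Sum>i\<le>k. f i * g (k - i)) sums ((\<Sum>k. f k) * (\<Sum>k. g k))"
    by (rule Cauchy_product_sums)
  also have "(\<lambda>k. \<Sum>i\<le>k. f i * g (k - i)) = (\<lambda>k. if k = 0 then 1 else 0)"
  proof
    fix k
    have "(\<Sum>i\<le>k. f i * g (k - i)) =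
        f 0 * g k + (\<Sum>i=1..k. f i * g (k - i))"
      by (simp add: atMost_atLeast0 sum.atLeast_Suc_atMost)
    also have "(\<Sum>i=1..k. f i * g (k - i)) =
        - c * z ^ k * (\<Sum>i=1..k. - binom_coeff a i * renewal a c (k - i))"
      unfolding sum_distrib_left
      by (rule sum.cong) (auto simp: f_def g_def simp flip: power_add)
    also have "f 0 * g k = (1 + c) * renewal a c k * z ^ k"
      by (simp add: f_def g_def)
    also have "(1 + c) * renewal a c k =
        (if k = 0 then 1 else c * (\<Sum>i=1..k. - binom_coeff a i * renewal a c (k - i)))"
      unfolding renewal.simps[of a c k] using c by auto
    finally show "(\<Sum>i\<le>k. f i * g (k - i)) = (if k = 0 then 1 else 0)"
      by auto
  qed
  finally have "(\<lambda>k::nat. if k = 0 then 1 else 0 :: real) sums ((1 + c * (1 - z) powr a) * (\<Sum>k. g k))"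
    using sums_unique[OF F] by simp
  moreover have "(\<lambda>k::nat. if k = 0 then 1 else 0 :: real) sums 1"
    using sums_single[of 0 "\<lambda>_. 1::real"] by simp
  ultimately have "(1 + c * (1 - z) powr a) * (\<Sum>k. g k) = 1"
    by (rule sums_unique2)
  moreover have "1 + c * (1 - z) powr a > 0" using c by (simp add: add_pos_nonneg)
  ultimately have "(\<Sum>k. g k) = 1 / (1 + c * (1 - z) powr a)"
    by (simp add: field_simps)
  then show ?thesis using summable_sums[OF summable_norm_cancel[OF G]] by (simp add: g_def)
qed

text \<open>
  The total mass is the limit of the generating function for \<open>z \<rightarrow> 1\<close>, by monotonicity in \<open>z\<close>.
\<close>
lemma renewal_sums_1:
  assumes a: "0 < a" "a \<le> 1" and c: "0 < c"
  shows "renewal a c sums 1"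
proof -
  note nn = renewal_bounds[OF a c, THEN conjunct1]
  have G: "((\<lambda>z. 1 / (1 + c * (1 - z) powr a)) \<longlongrightarrow> 1 / (1 + c * (1 - 1) powr a)) (at_left 1)"
    using a c by (intro tendsto_intros) (auto simp: eventually_at_filter)
  have z: "eventually (\<lambda>z::real. 0 \<le> z \<and> z < 1) (at_left 1)"
    by (rule eventually_mono[OF eventually_at_left_real[of 0]]) auto
  have bound: "(\<Sum>k<n. renewal a c k) \<le> 1" for n
  proof (rule tendsto_upperbound)
    show "((\<lambda>z. \<Sum>k<n. renewal a c k * z ^ k) \<longlongrightarrow> (\<Sum>k<n. renewal a c k)) (at_left 1)"
      by (rule tendsto_eq_intros refl | simp)+
    show "eventually (\<lambda>z. (\<Sum>k<n. renewal a c k * z ^ k) \<le> 1) (at_left 1)"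
      using z
    proof eventually_elim
      case (elim z)
      then have s: "(\<lambda>n. renewal a c n * z ^ n) sums (1 / (1 + c * (1 - z) powr a))"
        by (intro renewal_sums a c) auto
      have "(\<Sum>k<n. renewal a c k * z ^ k) \<le> (\<Sum>k. renewal a c k * z ^ k)"
        using s elim nn by (intro sum_le_suminf) (auto simp: sums_iff)
      also have "\<dots> \<le> 1" using s c by (auto simp: sums_iff field_simps add_pos_nonneg)
      finally show ?case .
    qed
  qed simp
  then have S: "summable (renewal a c)" by (intro summableI_nonneg_bounded nn)
  moreover have "suminf (renewal a c) \<le> 1" using S bound by (rule suminf_le_const)
  moreover have "1 \<le> suminf (renewal a c)"
  proof (rule tendsto_upperbound)
    show "((\<lambda>z. 1 / (1 + c * (1 - z) powr a)) \<longlongrightarrow> 1) (at_left 1)" using G by simp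
    show "eventually (\<lambda>z. 1 / (1 + c * (1 - z) powr a) \<le> suminf (renewal a c)) (at_left 1)"
      using z
    proof eventually_elim
      case (elim z)
      then have s: "(\<lambda>n. renewal a c n * z ^ n) sums (1 / (1 + c * (1 - z) powr a))"
        by (intro renewal_sums a c) auto
      show ?case unfolding sums_unique[OF s]
        using elim nn S s
        by (intro suminf_le) (auto simp: sums_iff intro!: mult_left_le power_le_one)
    qed
  qed simp
  ultimately show ?thesis by (simp add: sums_iff)
qed

lemma renewal_pmf:
  fixes a c :: real
  assumes a: "0 < a" "a \<le> 1" and c: "0 < c"
  obtains p :: "nat pmf" where
    "\<And>z :: real. \<lbrakk>0 \<le> z; z < 1\<rbrakk> \<Longrightarrow> measure_pmf.expectation p (\<lambda>k. z ^ k) = 1 / (1 + c * (1 - z) powr a)"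
proof
  note nn = renewal_bounds[OF a c, THEN conjunct1]
  define p where "p = embed_pmf (renewal a c)"
  have pmf: "pmf p k = renewal a c k" for k
    unfolding p_def
  proof (rule pmf_embed_pmf)
    have "(\<integral>\<^sup>+ k. ennreal (renewal a c k) \<partial>count_space UNIV) = (\<Sum>k. ennreal (renewal a c k))"
      by (rule nn_integral_count_space_nat)
    also have "\<dots> = ennreal 1"
      using renewal_sums_1[OF a c] nn by (subst suminf_ennreal2) (auto simp: sums_iff)
    finally show "(\<integral>\<^sup>+ k. ennreal (renewal a c k) \<partial>count_space UNIV) = 1" by simp
  qed (rule nn)
  fix z :: real assume z: "0 \<le> z" "z < 1"
  have s: "(\<lambda>n. renewal a c n * z ^ n) sums (1 / (1 + c * (1 - z) powr a))"
    by (rule renewal_sums[OF a c z])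
  have "integrable (count_space UNIV) (\<lambda>k. renewal a c k * z ^ k)"
    unfolding integrable_count_space_nat_iff using s nn z by (auto simp: sums_iff)
  then have "(\<integral>k. renewal a c k * z ^ k \<partial>count_space UNIV) = 1 / (1 + c * (1 - z) powr a)"
    using s by (simp add: integral_count_space_nat sums_iff)
  then show "measure_pmf.expectation p (\<lambda>k. z ^ k) = 1 / (1 + c * (1 - z) powr a)"
    unfolding measure_pmf_eq_density by (subst integral_density) (auto simp: pmf nn)
qed

text \<open>
  Half of the continuity theorem for Laplace transforms. Tightness follows from
  \<open>(1 - 1/e) P(X > 1/u) \<le> 1 - E exp(- u X)\<close>; the assumption that the transforms stay above their limit
  makes this bound uniform in \<open>n\<close>.
\<close>
lemma laplace_limit_law:
  fixes \<mu> :: "nat \<Rightarrow> real measure" and \<phi> :: "real \<Rightarrow> real"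
  assumes \<mu>: "\<And>n. real_distribution (\<mu> n)" "\<And>n. AE x in \<mu> n. 0 \<le> x"
    and lim: "\<And>u. 0 < u \<Longrightarrow> (\<lambda>n. \<integral>x. exp (- u * x) \<partial>\<mu> n) \<longlonglongrightarrow> \<phi> u"
    and lower: "\<And>n u. 0 < u \<Longrightarrow> \<phi> u \<le> (\<integral>x. exp (- u * x) \<partial>\<mu> n)"
    and \<phi>0: "(\<phi> \<longlongrightarrow> 1) (at_right 0)"
  obtains M where "real_distribution M" "AE x in M. 0 \<le> x"
    "\<And>u. 0 < u \<Longrightarrow> (\<integral>x. exp (- u * x) \<partial>M) = \<phi> u"
proof -
  interpret \<mu>: real_distribution "\<mu> n" for n by (rule \<mu>)
  have int_exp: "integrable N (\<lambda>x. exp (- u * x))"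
    if "real_distribution N" "AE x in N. 0 \<le> x" "0 < u" for N and u :: real
  proof -
    interpret N: real_distribution N by fact
    show ?thesis
      using that(2,3) by (intro N.integrable_const_bound[where B = 1]) auto
  qed
  have "tight \<mu>"
    unfolding tight_def
  proof (intro conjI allI impI \<mu>)
    fix \<epsilon> :: real assume \<epsilon>: "0 < \<epsilon>"
    define d where "d = 1 - exp (- 1 :: real)"
    have d: "0 < d" by (simp add: d_def)
    have "eventually (\<lambda>u. 1 - \<epsilon> * d < \<phi> u) (at_right 0)"
      using order_tendstoD(1)[OF \<phi>0, of "1 - \<epsilon> * d"] \<epsilon> d by simp
    moreover have "eventually (\<lambda>u::real. 0 < u) (at_right 0)"
      by (rule eventually_at_right_less)
    ultimately have "eventually (\<lambda>u. 1 - \<epsilon> * d < \<phi> u \<and> 0 < u) (at_right 0)"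
      by eventually_elim simp
    then obtain u where u: "1 - \<epsilon> * d < \<phi> u" "0 < u"
      using eventually_happens[of _ "at_right (0::real)"] by auto
    show "\<exists>a b. a < b \<and> (\<forall>n. 1 - \<epsilon> < measure (\<mu> n) {a<..b})"
    proof (rule exI[of _ "- 1"], rule exI[of _ "1 / u"], intro conjI allI)
      show "- 1 < 1 / u" using u(2) by (simp add: order_less_trans[of _ 0])
      fix n
      note i = int_exp[OF \<mu>(1) \<mu>(2) u(2), of n]
      have "(\<integral>x. exp (- u * x) \<partial>\<mu> n) \<le> (\<integral>x. (1 - d) + d * indicator {- 1<..1 / u} x \<partial>\<mu> n)"
      proof (rule integral_mono_AE[OF i])
        show "integrable (\<mu> n) (\<lambda>x. (1 - d) + d * indicator {- 1<..1 / u} x)"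
          by (intro Bochner_Integration.integrable_add integrable_mult_right \<mu>.integrable_const
              integrable_real_indicator) (auto simp: less_top[symmetric])
        show "AE x in \<mu> n. exp (- u * x) \<le> (1 - d) + d * indicator {- 1<..1 / u} x"
          using \<mu>(2)
        proof eventually_elim
          case (elim x)
          then show ?case using u(2)
            by (cases "x \<le> 1 / u") (auto simp: d_def field_simps split: split_indicator)
        qed
      qed
      also have "\<dots> = (1 - d) + d * measure (\<mu> n) {- 1<..1 / u}"
        using \<mu>.prob_space[of n] by (subst Bochner_Integration.integral_add)
           (auto simp: less_top[symmetric] intro!: integrable_real_indicator)
      finally have "d * (1 - \<epsilon>) < d * measure (\<mu> n) {- 1<..1 / u}"
        using lower[OF u(2), of n] u(1) by (simp add: algebra_simps)
      then show "1 - \<epsilon> < measure (\<mu> n) {- 1<..1 / u}" using d by simp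
    qed
  qed
  then obtain r M where r: "strict_mono (r :: nat \<Rightarrow> nat)" and M: "real_distribution M"
    and w: "weak_conv_m (\<mu> \<circ> id \<circ> r) M"
    using tight_imp_convergent_subsubsequence[of \<mu> id] by (auto simp: strict_mono_def)
  interpret M: real_distribution M by fact
  have conv: "(\<lambda>n. \<integral>x. f x \<partial>\<mu> (r n)) \<longlonglongrightarrow> (\<integral>x. f x \<partial>M)"
    if "continuous_on UNIV f" "\<And>x. \<bar>f x\<bar> \<le> B" for f :: "real \<Rightarrow> real" and B
    using weak_conv_imp_integral_bdd_continuous_conv[of "\<mu> \<circ> id \<circ> r" M f B, OF _ M w] \<mu>(1) that
    by (auto simp: continuous_on_eq_continuous_at)
  have M_nonneg: "AE x in M. 0 \<le> x"
  proof -
    \<comment> \<open>a bounded continuous test function that is positive exactly on the negative half-line\<close>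
    define f where "f x = min 1 (max 0 (- x))" for x :: real
    have "(\<integral>x. f x \<partial>\<mu> n) = (\<integral>x. 0 \<partial>\<mu> n)" for n
      by (rule integral_cong_AE) (use \<mu>(2)[of n] in \<open>auto simp: f_def\<close>)
    moreover have "(\<lambda>n. \<integral>x. f x \<partial>\<mu> (r n)) \<longlonglongrightarrow> (\<integral>x. f x \<partial>M)"
      by (rule conv[of _ 1]) (auto simp: f_def[abs_def] intro!: continuous_intros)
    ultimately have "(\<lambda>n. 0) \<longlonglongrightarrow> (\<integral>x. f x \<partial>M)" by simp
    then have "(\<integral>x. f x \<partial>M) = 0" by (simp add: LIMSEQ_const_iff)
    moreover have "integrable M f"
      by (rule M.integrable_const_bound[where B = 1]) (auto simp: f_def[abs_def])
    ultimately have "AE x in M. f x = 0"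
      by (subst (asm) integral_nonneg_eq_0_iff_AE) (auto simp: f_def)
    then show ?thesis by eventually_elim (auto simp: f_def min_def max_def split: if_splits)
  qed
  show ?thesis
  proof (rule that[OF M M_nonneg])
    fix u :: real assume u: "0 < u"
    \<comment> \<open>\<open>exp (- u * x)\<close> is unbounded on the whole line; this test function agrees with it on the support\<close>
    define f where "f x = exp (- u * max 0 x)" for x :: real
    have eq: "(\<integral>x. exp (- u * x) \<partial>N) = (\<integral>x. f x \<partial>N)"
      if N: "real_distribution N" "AE x in N. 0 \<le> x" for N
    proof -
      interpret N: real_distribution N by fact
      have "AE x in N. exp (- u * x) = f x"
        using N(2) by eventually_elim (simp add: f_def)
      then show ?thesis by (intro integral_cong_AE) (auto simp: f_def[abs_def])
    qed
    have "(\<lambda>n. \<integral>x. f x \<partial>\<mu> (r n)) \<longlonglongrightarrow> (\<integral>x. f x \<partial>M)"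
      by (rule conv[of _ 1]) (use u in \<open>auto simp: f_def[abs_def] intro!: continuous_intros\<close>)
    moreover have "(\<lambda>n. \<integral>x. f x \<partial>\<mu> (r n)) \<longlonglongrightarrow> \<phi> u"
      using LIMSEQ_subseq_LIMSEQ[OF lim[OF u] r] eq[OF \<mu>] by (simp add: o_def)
    ultimately show "(\<integral>x. exp (- u * x) \<partial>M) = \<phi> u"
      using eq[OF M M_nonneg] by (simp add: LIMSEQ_unique)
  qed
qed

text \<open>
  The lattice law of width \<open>1/N\<close> with \<open>c = N\<^sup>a\<close> has the transform \<open>1 / (1 + h\<^sup>a)\<close> with
  \<open>h = N (1 - exp (- u/N))\<close>, and \<open>h\<close> tends to \<open>u\<close> from below. There is no mass at zero because the
  limit transform vanishes at infinity.
\<close>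
lemma mittag_leffler_law:
  assumes a: "0 < a" "a \<le> 1"
  obtains M :: "real measure" where "real_distribution M" "AE x in M. 0 < x"
    "\<And>u. 0 \<le> u \<Longrightarrow> (\<integral>x. exp (- u * x) \<partial>M) = 1 / (1 + u powr a)"
proof -
  define h where "h n u = real (Suc n) * (1 - exp (- (u / real (Suc n))))" for n and u :: real
  have "\<exists>p :: nat pmf. \<forall>z. 0 \<le> z \<and> z < 1 \<longrightarrow>
      measure_pmf.expectation p (\<lambda>k. z ^ k) = 1 / (1 + real (Suc n) powr a * (1 - z) powr a)" for n
  proof -
    have "0 < real (Suc n) powr a" by simp
    then show ?thesis by (rule renewal_pmf[OF a]) blast
  qed
  then obtain p :: "nat \<Rightarrow> nat pmf" where p: "\<And>n z. \<lbrakk>0 \<le> z; z < 1\<rbrakk> \<Longrightarrow>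
      measure_pmf.expectation (p n) (\<lambda>k. z ^ k) = 1 / (1 + real (Suc n) powr a * (1 - z) powr a)"
    by metis
  define \<mu> where "\<mu> n = distr (measure_pmf (p n)) borel (\<lambda>k. real k / real (Suc n))" for n
  have laplace: "(\<integral>x. exp (- u * x) \<partial>\<mu> n) = 1 / (1 + h n u powr a)" if u: "0 < u" for n u
  proof -
    have "(\<integral>x. exp (- u * x) \<partial>\<mu> n) =
        measure_pmf.expectation (p n) (\<lambda>k. exp (- (u / real (Suc n))) ^ k)"
      unfolding \<mu>_def
      by (subst integral_distr)
         (auto simp: exp_of_nat_mult[symmetric] mult.commute intro!: Bochner_Integration.integral_cong)
    also have "\<dots> = 1 / (1 + real (Suc n) powr a * (1 - exp (- (u / real (Suc n)))) powr a)"
      using u by (intro p) auto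
    also have "\<dots> = 1 / (1 + h n u powr a)"
      unfolding h_def using u by (subst powr_mult) auto
    finally show ?thesis .
  qed
  have h_nonneg: "0 \<le> h n u" if "0 < u" for n u
    using that by (simp add: h_def)
  have h_le: "h n u \<le> u" if "0 < u" for n u
  proof -
    have "h n u \<le> real (Suc n) * (u / real (Suc n))"
      unfolding h_def using exp_ge_add_one_self[of "- (u / real (Suc n))"]
      by (intro mult_left_mono) auto
    then show ?thesis by simp
  qed
  have h_lim: "(\<lambda>n. h n u) \<longlonglongrightarrow> u" for u
    unfolding h_def by real_asymp
  obtain M where M: "real_distribution M" "AE x in M. 0 \<le> x"
    and L: "\<And>u. 0 < u \<Longrightarrow> (\<integral>x. exp (- u * x) \<partial>M) = 1 / (1 + u powr a)"
  proof (rule laplace_limit_law[of \<mu> "\<lambda>u. 1 / (1 + u powr a)"])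
    show "real_distribution (\<mu> n)" for n
      unfolding \<mu>_def
      by (simp add: prob_space.real_distribution_distr measure_pmf.prob_space_axioms)
    show "AE x in \<mu> n. 0 \<le> x" for n
      unfolding \<mu>_def by (subst AE_distr_iff) auto
    show "(\<lambda>n. \<integral>x. exp (- u * x) \<partial>\<mu> n) \<longlonglongrightarrow> 1 / (1 + u powr a)" if u: "0 < u" for u
      unfolding laplace[OF u]
      by (intro tendsto_intros h_lim) (use u in \<open>auto simp: add_pos_nonneg pos_add_strict less_imp_neq[THEN not_sym]\<close>)
    show "1 / (1 + u powr a) \<le> (\<integral>x. exp (- u * x) \<partial>\<mu> n)" if u: "0 < u" for n u
      unfolding laplace[OF u] using h_le[OF u] h_nonneg[OF u] a
      by (intro divide_left_mono add_left_mono powr_mono2 mult_pos_pos add_pos_nonneg) auto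
    have "((\<lambda>u. 1 / (1 + u powr a)) \<longlongrightarrow> 1 / (1 + 0 powr a)) (at_right (0::real))"
      using a by (intro tendsto_intros) (auto simp: eventually_at_right_less eventually_at_filter)
    then show "((\<lambda>u. 1 / (1 + u powr a)) \<longlongrightarrow> 1) (at_right (0::real))" by simp
  qed blast
  interpret M: real_distribution M by fact
  have "M.prob {..0} \<le> 1 / (1 + u powr a)" if u: "0 < u" for u
  proof -
    have "M.prob {..0} = (\<integral>x. indicator {..0} x \<partial>M)" by simp
    also have "\<dots> \<le> (\<integral>x. exp (- u * x) \<partial>M)"
    proof (rule integral_mono_AE)
      show "integrable M (\<lambda>x. exp (- u * x))"
        using M(2) u by (intro M.integrable_const_bound[where B = 1]) auto
      show "AE x in M. indicator {..0} x \<le> exp (- u * x)"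
        using u by (auto split: split_indicator simp: mult_le_0_iff)
    qed (auto intro!: integrable_real_indicator simp: less_top[symmetric])
    finally show ?thesis using L[OF u] by simp
  qed
  moreover have "((\<lambda>u. 1 / (1 + u powr a)) \<longlongrightarrow> 0) at_top" using a by real_asymp
  ultimately have "M.prob {..0} \<le> 0"
    by (intro tendsto_lowerbound[where F = at_top and f = "\<lambda>u. 1 / (1 + u powr a)"])
       (auto intro: eventually_mono[OF eventually_gt_at_top[of 0]])
  then have "AE x in M. x \<notin> {..0}"
    by (subst (asm) measure_le_0_iff) (auto simp: M.prob_eq_0)
  then have "AE x in M. 0 < x" by eventually_elim auto
  then show ?thesis
  proof (rule that[OF M(1)])
    show "(\<integral>x. exp (- u * x) \<partial>M) = 1 / (1 + u powr a)" if "0 \<le> u" for u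
      using L[of u] that M.prob_space by (cases "u = 0") auto
  qed
qed

section \<open>Scaled and mixed laws on the orthant\<close>

lemma borel_measurable_vec_lambdaI:
  fixes f :: "'n::finite \<Rightarrow> 'a \<Rightarrow> real"
  assumes "\<And>i. f i \<in> borel_measurable M"
  shows "(\<lambda>x. \<chi> i. f i x) \<in> borel_measurable M"
  unfolding borel_measurable_euclidean_space[of "\<lambda>x. \<chi> i. f i x"]
  using assms by (auto simp: Basis_vec_def inner_axis)

lemma borel_measurable_vec_nth [measurable (raw)]:
  fixes f :: "'a \<Rightarrow> real^'n"
  assumes f: "f \<in> borel_measurable M"
  shows "(\<lambda>x. f x $ i) \<in> borel_measurable M"
proof -
  have "(\<lambda>v :: real^'n. v $ i) \<in> borel_measurable borel"
    by (intro borel_measurable_continuous_onI continuous_intros)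
  from measurable_compose[OF f this] show ?thesis .
qed

lemma borel_measurable_vec_times [measurable (raw)]:
  fixes f g :: "'a \<Rightarrow> real^'n"
  assumes [measurable]: "f \<in> borel_measurable M" "g \<in> borel_measurable M"
  shows "(\<lambda>x. f x * g x) \<in> borel_measurable M"
  unfolding times_vec_def by (rule borel_measurable_vec_lambdaI) measurable

lemma borel_measurable_vpowr [measurable (raw)]:
  fixes f :: "'a \<Rightarrow> real^'n"
  assumes [measurable]: "f \<in> borel_measurable M"
  shows "(\<lambda>x. vpowr (f x) a) \<in> borel_measurable M"
  unfolding vpowr_def by (rule borel_measurable_vec_lambdaI) measurable

lemma nonneg_vec_vpowr: "nonneg_vec (vpowr x a)"
  by (simp add: nonneg_vec_def vpowr_def)

lemma nonneg_vec_times: "nonneg_vec x \<Longrightarrow> nonneg_vec y \<Longrightarrow> nonneg_vec (x * y)"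
  by (simp add: nonneg_vec_def)

lemma vpowr_times:
  "nonneg_vec x \<Longrightarrow> nonneg_vec y \<Longrightarrow> vpowr (x * y) a = vpowr x a * vpowr y a"
  by (simp add: nonneg_vec_def vpowr_def Finite_Cartesian_Product.vec_eq_iff powr_mult)

lemma vpowr_inverse_exponent:
  assumes "nonneg_vec x" "pos_vec \<nu>"
  shows "vpowr (vpowr x \<nu>) (\<chi> i. 1 / \<nu> $ i) = x"
  using assms
  by (auto simp: nonneg_vec_def pos_vec_def vpowr_def Finite_Cartesian_Product.vec_eq_iff powr_powr less_imp_neq[THEN not_sym])

lemma inner_times_vec: "(x :: real^'n) \<bullet> (y * z) = (x * y) \<bullet> z"
  by (simp add: inner_vec_def mult.assoc)

lemma inner_nonneg_vec: "nonneg_vec x \<Longrightarrow> nonneg_vec y \<Longrightarrow> 0 \<le> x \<bullet> y"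
  by (simp add: inner_vec_def nonneg_vec_def sum_nonneg)

lemma orthant_law_distr:
  assumes M: "prob_space M" and f: "f \<in> borel_measurable M" and nn: "AE x in M. nonneg_vec (f x)"
  shows "orthant_law (distr M borel f)"
proof -
  have [measurable]: "Measurable.pred borel (nonneg_vec :: real^'n \<Rightarrow> bool)"
    unfolding nonneg_vec_def by measurable
  show ?thesis
    unfolding orthant_law_def
    using prob_space.prob_space_distr[OF M f] nn f by (auto simp: AE_distr_iff)
qed

lemma orthant_law_times:
  fixes M Q :: "(real^'n) measure"
  assumes M: "orthant_law M" and Q: "orthant_law Q"
    and c[measurable]: "c \<in> borel_measurable borel" and c_nonneg: "\<And>x. nonneg_vec (c x)"
  shows "orthant_law (distr (M \<Otimes>\<^sub>M Q) borel (\<lambda>(x, z). c x * z))"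
    and "\<And>g :: real^'n \<Rightarrow> real. \<lbrakk>g \<in> borel_measurable borel; \<And>y. nonneg_vec y \<Longrightarrow> \<bar>g y\<bar> \<le> B\<rbrakk> \<Longrightarrow>
      (\<integral>y. g y \<partial>distr (M \<Otimes>\<^sub>M Q) borel (\<lambda>(x, z). c x * z)) = (\<integral>x. \<integral>z. g (c x * z) \<partial>Q \<partial>M)"
proof -
  interpret M: prob_space M using M by (simp add: orthant_law_def)
  interpret Q: prob_space Q using Q by (simp add: orthant_law_def)
  interpret MQ: pair_prob_space M Q ..
  have [measurable_cong]: "sets M = sets borel" "sets Q = sets borel"
    using M Q by (auto simp: orthant_law_def)
  have [measurable]: "Measurable.pred borel (nonneg_vec :: real^'n \<Rightarrow> bool)"
    unfolding nonneg_vec_def by measurable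
  have "AE x in M. AE z in Q. nonneg_vec (c x * z)"
    using Q by (auto simp: orthant_law_def intro!: nonneg_vec_times c_nonneg elim!: eventually_mono)
  then have nn: "AE p in M \<Otimes>\<^sub>M Q. nonneg_vec (case p of (x, z) \<Rightarrow> c x * z)"
    by (intro MQ.AE_pair_measure) auto
  then show "orthant_law (distr (M \<Otimes>\<^sub>M Q) borel (\<lambda>(x, z). c x * z))"
    by (intro orthant_law_distr MQ.prob_space_axioms) auto
  fix g :: "real^'n \<Rightarrow> real"
  assume [measurable]: "g \<in> borel_measurable borel" and g: "\<And>y. nonneg_vec y \<Longrightarrow> \<bar>g y\<bar> \<le> B"
  have "integrable (M \<Otimes>\<^sub>M Q) (\<lambda>p. g (case p of (x, z) \<Rightarrow> c x * z))"
    using nn by (intro MQ.integrable_const_bound[where B = B]) (auto elim!: eventually_mono intro: g)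
  from MQ.integral_fst'[OF this]
  show "(\<integral>y. g y \<partial>distr (M \<Otimes>\<^sub>M Q) borel (\<lambda>(x, z). c x * z)) = (\<integral>x. \<integral>z. g (c x * z) \<partial>Q \<partial>M)"
    by (simp add: integral_distr)
qed

text \<open>
  The push-forward under \<open>c\<close> is a discrete law with atoms \<open>b k\<close>; their weights later become the initial
  vector of a representation.
\<close>
lemma integral_finite_range:
  fixes g :: "'b::t1_space \<Rightarrow> real" and K :: nat
  assumes M: "prob_space M" and c: "c \<in> borel_measurable M"
    and b: "bij_betw b {..<K} (c ` space M)"
  shows "(\<integral>x. g (c x) \<partial>M) = (\<Sum>k<K. measure M (c -` {b k} \<inter> space M) * g (b k))"
proof -
  interpret prob_space M by fact
  have eq: "g (c x) = (\<Sum>k<K. g (b k) * indicator (c -` {b k} \<inter> space M) x)" if "x \<in> space M" for x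
  proof -
    have "c x \<in> b ` {..<K}" using b that by (simp add: bij_betw_def)
    then obtain k0 where k0: "k0 < K" "c x = b k0" by auto
    have "(\<Sum>k<K. g (b k) * indicator (c -` {b k} \<inter> space M) x) =
        (\<Sum>k<K. if k = k0 then g (b k0) else 0)"
    proof (rule sum.cong[OF refl])
      fix k assume "k \<in> {..<K}"
      then have "b k0 = b k \<longleftrightarrow> k = k0" using b k0 by (auto simp: bij_betw_def inj_on_def)
      then show "g (b k) * indicator (c -` {b k} \<inter> space M) x = (if k = k0 then g (b k0) else 0)"
        using k0 that by (auto simp: indicator_def)
    qed
    then show ?thesis using k0 by simp
  qed
  have sets: "c -` {b k} \<inter> space M \<in> sets M" for k
    using c by (rule measurable_sets) simp
  have "(\<integral>x. g (c x) \<partial>M) = (\<integral>x. (\<Sum>k<K. g (b k) * indicator (c -` {b k} \<inter> space M) x) \<partial>M)"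
    by (rule Bochner_Integration.integral_cong[OF refl eq])
  also have "\<dots> = (\<Sum>k<K. \<integral>x. g (b k) * indicator (c -` {b k} \<inter> space M) x \<partial>M)"
    by (rule Bochner_Integration.integral_sum)
       (auto intro!: integrable_real_indicator sets simp: less_top[symmetric])
  also have "\<dots> = (\<Sum>k<K. measure M (c -` {b k} \<inter> space M) * g (b k))"
    by (intro sum.cong) (auto simp: mult.commute)
  finally show ?thesis .
qed

section \<open>Approximation by mixtures of scaled chain laws\<close>

text \<open>
  A law represented by a single chain with reward row \<open>s l\<close> at its place \<open>l\<close>: the building block of
  all approximating laws.
\<close>
definition chain_law :: "real^'n \<Rightarrow> nat \<Rightarrow> (nat \<Rightarrow> real^'n) \<Rightarrow> (real^'n) measure \<Rightarrow> bool" where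
  "chain_law \<alpha> L s Q \<longleftrightarrow> orthant_law Q \<and> 0 < L \<and> (\<forall>l<L. nonneg_vec (s l)) \<and>
     (\<forall>u. nonneg_vec u \<longrightarrow> (\<integral>z. exp (- (u \<bullet> z)) \<partial>Q) = (\<Prod>l<L. 1 / (1 + s l \<bullet> vpowr u \<alpha>)))"

text \<open>
  Conditionally on \<open>c x = b\<close> the product is a chain law with its rewards multiplied by
  \<open>vpowr b \<alpha>\<close>, because \<open>vpowr (u * b) \<alpha> = vpowr u \<alpha> * vpowr b \<alpha>\<close>. Finiteness of the range of \<open>c\<close> keeps
  the number of parallel chains, hence the dimension, finite.
\<close>
lemma GMML_of_scaled_chain:
  fixes M Q :: "(real^'n) measure"
  assumes M: "orthant_law M" and Q: "chain_law \<alpha> L s Q"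
    and c[measurable]: "c \<in> borel_measurable borel" and fin: "finite (range c)"
    and c_nonneg: "\<And>x. nonneg_vec (c x)"
  shows "\<exists>p \<pi> T R. reward_rep p \<pi> T R \<and>
           is_GMML \<alpha> p \<pi> T R (distr (M \<Otimes>\<^sub>M Q) borel (\<lambda>(x, z). c x * z))"
proof -
  interpret M: prob_space M using M by (simp add: orthant_law_def)
  have sets_M: "sets M = sets borel" and [simp]: "space M = UNIV"
    using M sets_eq_imp_space_eq[of M borel] by (auto simp: orthant_law_def)
  have L: "0 < L" and s: "\<And>l. l < L \<Longrightarrow> nonneg_vec (s l)" and Q': "orthant_law Q"
    and transform: "\<And>u. nonneg_vec u \<Longrightarrow>
      (\<integral>z. exp (- (u \<bullet> z)) \<partial>Q) = (\<Prod>l<L. 1 / (1 + s l \<bullet> vpowr u \<alpha>))"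
    using Q by (auto simp: chain_law_def)
  obtain b where "bij_betw b {0..<card (range c)} (range c)"
    using ex_bij_betw_nat_finite[OF fin] by blast
  then obtain K :: nat where b: "bij_betw b {..<K} (range c)"
    by (metis atLeast0LessThan)
  define w where "w k = measure M (c -` {b k})" for k
  define r where "r k l = vpowr (b k) \<alpha> * s l" for k l
  have b_nonneg: "nonneg_vec (b k)" if "k < K" for k
  proof -
    have "b k \<in> range c" using bij_betwE[OF b] that by simp
    then show ?thesis using c_nonneg by auto
  qed
  have r_nonneg: "nonneg_vec (r k l)" if "l < L" for k l
    unfolding r_def by (intro nonneg_vec_times nonneg_vec_vpowr s that)
  have mixture: "(\<integral>x. g (c x) \<partial>M) = (\<Sum>k<K. w k * g (b k))" for g :: "real^'n \<Rightarrow> real"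
    unfolding w_def
    using integral_finite_range[OF M.prob_space_axioms, of c b K g] b c
    by (simp add: measurable_cong_sets[OF sets_M refl])
  have "(\<Sum>k<K. w k) = 1"
    using mixture[of "\<lambda>_. 1"] M.prob_space by simp
  then have rep: "reward_rep (K * L) (chains_start K L w) (chains_subint K L)
      (\<lambda>i. r (i div L) (i mod L))"
    by (intro reward_rep_chains L r_nonneg) (auto simp: w_def)
  have "is_GMML \<alpha> (K * L) (chains_start K L w) (chains_subint K L) (\<lambda>i. r (i div L) (i mod L))
      (distr (M \<Otimes>\<^sub>M Q) borel (\<lambda>(x, z). c x * z))"
    unfolding is_GMML_def
  proof (intro conjI allI impI orthant_law_times(1)[OF M Q' c c_nonneg])
    fix u :: "real^'n" assume u: "nonneg_vec u"
    have "(\<integral>y. exp (- (u \<bullet> y)) \<partial>distr (M \<Otimes>\<^sub>M Q) borel (\<lambda>(x, z). c x * z)) =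
        (\<integral>x. \<integral>z. exp (- (u \<bullet> (c x * z))) \<partial>Q \<partial>M)"
      by (rule orthant_law_times(2)[OF M Q' c c_nonneg, where B = 1])
         (auto simp: inner_nonneg_vec[OF u])
    also have "\<dots> = (\<integral>x. (\<Prod>l<L. 1 / (1 + s l \<bullet> vpowr (u * c x) \<alpha>)) \<partial>M)"
      unfolding inner_times_vec
      by (intro Bochner_Integration.integral_cong refl transform nonneg_vec_times u c_nonneg)
    also have "\<dots> = (\<Sum>k<K. w k * (\<Prod>l<L. 1 / (1 + s l \<bullet> vpowr (u * b k) \<alpha>)))"
      by (rule mixture)
    also have "\<dots> = (\<Sum>k<K. w k * (\<Prod>l<L. 1 / (1 + r k l \<bullet> vpowr u \<alpha>)))"
      using b_nonneg
      by (intro sum.cong refl arg_cong2[where f = "(*)"] prod.cong)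
         (simp add: vpowr_times[OF u] r_def inner_times_vec[symmetric] mult.commute inner_vec_def mult_ac)
    also have "\<dots> = gmml_transform \<alpha> (K * L) (chains_start K L w) (chains_subint K L)
        (\<lambda>i. r (i div L) (i mod L)) u"
      by (rule gmml_transform_chains[symmetric]) (use L r_nonneg in auto)
    finally show "(\<integral>y. exp (- (u \<bullet> y)) \<partial>distr (M \<Otimes>\<^sub>M Q) borel (\<lambda>(x, z). c x * z)) =
        gmml_transform \<alpha> (K * L) (chains_start K L w) (chains_subint K L)
          (\<lambda>i. r (i div L) (i mod L)) u" .
  qed
  with rep show ?thesis by blast
qed

text \<open>
  Slutsky's argument: by continuity of \<open>(b, y) \<mapsto> f (b * y)\<close> at \<open>(x, 1)\<close> the integrand is close to
  \<open>f x\<close> where \<open>Y k\<close> is close to \<open>1\<close>, and the remaining set has vanishing probability.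
\<close>
lemma integral_scaled_tendsto:
  fixes f :: "real^'n \<Rightarrow> real" and Q :: "nat \<Rightarrow> 'a measure" and Y :: "nat \<Rightarrow> 'a \<Rightarrow> real^'n"
  assumes f: "continuous_on UNIV f" "\<And>x. \<bar>f x\<bar> \<le> B"
    and Q: "\<And>k. prob_space (Q k)" and Y: "\<And>k. Y k \<in> borel_measurable (Q k)"
    and conc: "\<And>\<epsilon>. 0 < \<epsilon> \<Longrightarrow> (\<lambda>k. measure (Q k) {z \<in> space (Q k). \<epsilon> \<le> dist (Y k z) 1}) \<longlonglongrightarrow> 0"
    and b: "b \<longlonglongrightarrow> x"
  shows "(\<lambda>k. \<integral>z. f (b k * Y k z) \<partial>Q k) \<longlonglongrightarrow> f x"
proof (rule tendstoI)
  fix \<epsilon> :: real assume \<epsilon>: "0 < \<epsilon>"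
  interpret Q: prob_space "Q k" for k by (rule Q)
  have [measurable]: "f \<in> borel_measurable borel"
    by (rule borel_measurable_continuous_onI[OF f(1)])
  have B: "0 \<le> B" using f(2)[of 0] by linarith
  define G where "G p = f (fst p * snd p)" for p :: "(real^'n) \<times> (real^'n)"
  have "continuous_on UNIV G"
    unfolding G_def times_vec_def
    by (rule continuous_on_compose2[OF f(1)]) (auto intro!: continuous_intros)
  then have "isCont G (x, 1)"
    by (simp add: continuous_on_eq_continuous_at)
  then have "(G \<longlongrightarrow> G (x, 1)) (nhds (x, 1))"
    unfolding isCont_def by (simp add: tendsto_at_iff_tendsto_nhds)
  then have "eventually (\<lambda>p. dist (f (fst p * snd p)) (f x) < \<epsilon> / 2) (nhds (x, 1))"
    using \<epsilon> by (auto dest!: tendstoD[of _ _ _ "\<epsilon> / 2"] simp: G_def)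
  then obtain P1 P2 where P: "eventually P1 (nhds x)" "eventually P2 (nhds 1)"
    "\<And>y z. P1 y \<Longrightarrow> P2 z \<Longrightarrow> \<bar>f (y * z) - f x\<bar> < \<epsilon> / 2"
    unfolding nhds_prod eventually_prod_filter by (auto simp: dist_real_def)
  obtain \<delta> where \<delta>: "0 < \<delta>" "\<And>z. dist z 1 < \<delta> \<Longrightarrow> P2 z"
    using P(2) unfolding eventually_nhds_metric by auto
  define m where "m k = measure (Q k) {z \<in> space (Q k). \<delta> \<le> dist (Y k z) 1}" for k
  have "(\<lambda>k. 2 * B * m k) \<longlonglongrightarrow> 2 * B * 0"
    unfolding m_def by (intro tendsto_intros conc \<delta>)
  then have "eventually (\<lambda>k. 2 * B * m k < \<epsilon> / 2) sequentially"
    using \<epsilon> by (auto dest: order_tendstoD(2)[of _ _ _ "\<epsilon> / 2"])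
  moreover have "eventually (\<lambda>k. P1 (b k)) sequentially"
    using P(1) b by (rule eventually_compose_filterlim)
  ultimately show "eventually (\<lambda>k. dist (\<integral>z. f (b k * Y k z) \<partial>Q k) (f x) < \<epsilon>) sequentially"
  proof eventually_elim
    case (elim k)
    note [measurable] = Y[of k]
    define A where "A = {z \<in> space (Q k). \<delta> \<le> dist (Y k z) 1}"
    have A: "A \<in> sets (Q k)" unfolding A_def by measurable
    have int: "integrable (Q k) (\<lambda>z. f (b k * Y k z))"
      using f(2) by (intro Q.integrable_const_bound[where B = B]) auto
    have intA: "integrable (Q k) (indicator A :: _ \<Rightarrow> real)"
      using A by (intro integrable_real_indicator) (auto simp: less_top[symmetric])
    have "\<bar>(\<integral>z. f (b k * Y k z) \<partial>Q k) - f x\<bar> = \<bar>\<integral>z. f (b k * Y k z) - f x \<partial>Q k\<bar>"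
      using int Q.prob_space[of k] by simp
    also have "\<dots> \<le> (\<integral>z. \<bar>f (b k * Y k z) - f x\<bar> \<partial>Q k)"
      by (rule integral_abs_bound)
    also have "\<dots> \<le> (\<integral>z. \<epsilon> / 2 + 2 * B * indicator A z \<partial>Q k)"
    proof (rule integral_mono)
      fix z assume z: "z \<in> space (Q k)"
      show "\<bar>f (b k * Y k z) - f x\<bar> \<le> \<epsilon> / 2 + 2 * B * indicator A z"
      proof (cases "z \<in> A")
        case True
        then show ?thesis using f(2)[of x] f(2)[of "b k * Y k z"] \<epsilon> by simp
      next
        case False
        then have "P2 (Y k z)" using z \<delta>(2) by (auto simp: A_def)
        then show ?thesis using P(3)[OF elim(2)] False by (simp add: less_imp_le)
      qed
    qed (use int intA in auto)
    also have "\<dots> = \<epsilon> / 2 + 2 * B * m k"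
      using A intA Q.prob_space[of k] sets.sets_into_space[OF A]
      by (subst Bochner_Integration.integral_add) (auto simp: m_def A_def Int_absorb2)
    also have "\<dots> < \<epsilon>" using elim(1) by simp
    finally show ?case by (simp add: dist_real_def)
  qed
qed

text \<open>
  The approximating vector is \<open>d k x * z\<^sup>1\<^sup>/\<^sup>\<nu>\<close> with simple functions \<open>d k\<close> that converge to the identity.
  Integrating first over \<open>z\<close> reduces weak convergence to a pointwise limit in \<open>x\<close> and dominated
  convergence.
\<close>
lemma GMML_pow_approximation:
  fixes M :: "(real^'n) measure"
  assumes \<nu>: "\<And>k. pos_vec (\<nu> k)" and Q: "\<And>k. chain_law \<alpha> (L k) (s k) (Q k)"
    and conc: "\<And>\<epsilon>. 0 < \<epsilon> \<Longrightarrow>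
      (\<lambda>k. measure (Q k) {z. \<epsilon> \<le> dist (vpowr z (\<chi> i. 1 / \<nu> k $ i)) 1}) \<longlonglongrightarrow> 0"
    and M: "orthant_law M"
  shows "\<exists>Ms. (\<forall>k. \<exists>p \<pi> T R. reward_rep p \<pi> T R \<and> is_GMML_pow (\<nu> k) \<alpha> p \<pi> T R (Ms k)) \<and>
           weak_conv_to Ms M"
proof -
  have Q': "orthant_law (Q k)" for k using Q[of k] by (simp add: chain_law_def)
  interpret M: prob_space M using M by (simp add: orthant_law_def)
  interpret Q: prob_space "Q k" for k using Q'[of k] by (simp add: orthant_law_def)
  have [measurable_cong]: "sets M = sets borel" and sets_Q[measurable_cong]: "\<And>k. sets (Q k) = sets borel"
    using M Q' by (auto simp: orthant_law_def)
  have space_Q [simp]: "space (Q k) = UNIV" for k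
    using sets_eq_imp_space_eq[OF sets_Q] by simp
  obtain F :: "nat \<Rightarrow> real^'n \<Rightarrow> real^'n" where F: "\<And>k. simple_function borel (F k)"
    "\<And>x. (\<lambda>k. F k x) \<longlonglongrightarrow> x"
    using borel_measurable_implies_sequence_metric[of "\<lambda>x :: real^'n. x" borel 0] by auto
  \<comment> \<open>simple functions may leave the orthant; absolute values bring them back and fix the limit there\<close>
  define d where "d k x = (\<chi> i. \<bar>F k x $ i\<bar>)" for k x
  have F_meas[measurable]: "F k \<in> borel_measurable borel" for k
    using F(1) by (rule borel_measurable_simple_function)
  have [measurable]: "d k \<in> borel_measurable borel" for k
    unfolding d_def by (rule borel_measurable_vec_lambdaI) measurable
  have d_nonneg: "nonneg_vec (d k x)" for k x by (simp add: d_def nonneg_vec_def)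
  have d_lim: "(\<lambda>k. d k x) \<longlonglongrightarrow> x" if "nonneg_vec x" for x
  proof -
    have "(\<lambda>k. d k x) \<longlonglongrightarrow> (\<chi> i. \<bar>x $ i\<bar>)"
      unfolding d_def by (intro tendsto_intros F(2))
    also have "(\<chi> i. \<bar>x $ i\<bar>) = x" using that by (simp add: nonneg_vec_def Finite_Cartesian_Product.vec_eq_iff)
    finally show ?thesis .
  qed
  \<comment> \<open>the scaling that the exponent \<open>1 / \<nu> k\<close> turns back into \<open>d k x\<close>\<close>
  define c where "c k x = vpowr (d k x) (\<nu> k)" for k x
  have c[measurable]: "c k \<in> borel_measurable borel" for k unfolding c_def by measurable
  have c_nonneg: "nonneg_vec (c k x)" for k x by (simp add: c_def nonneg_vec_vpowr)
  have fin: "finite (range (c k))" for k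
  proof -
    have "range (c k) = (\<lambda>y. vpowr (\<chi> i. \<bar>y $ i\<bar>) (\<nu> k)) ` range (F k)"
      by (auto simp: c_def d_def)
    then show ?thesis using simple_functionD(1)[OF F(1)[of k]] by simp
  qed
  define N where "N k = distr (M \<Otimes>\<^sub>M Q k) borel (\<lambda>(x, z). c k x * z)" for k
  define Ms where "Ms k = distr (N k) borel (\<lambda>y. vpowr y (\<chi> i. 1 / \<nu> k $ i))" for k
  have "\<exists>p \<pi> T R. reward_rep p \<pi> T R \<and> is_GMML_pow (\<nu> k) \<alpha> p \<pi> T R (Ms k)" for k
    using GMML_of_scaled_chain[OF M Q c fin c_nonneg, of k]
    unfolding is_GMML_pow_def Ms_def N_def by blast
  moreover have "weak_conv_to Ms M"
    unfolding weak_conv_to_def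
  proof (intro allI impI)
    fix f :: "real^'n \<Rightarrow> real"
    assume f: "continuous_on UNIV f \<and> bounded (range f)"
    then have [measurable]: "f \<in> borel_measurable borel"
      by (intro borel_measurable_continuous_onI) simp
    obtain B where B: "\<And>x. \<bar>f x\<bar> \<le> B" using f by (auto simp: bounded_iff)
    define J where "J k x = (\<integral>z. f (d k x * vpowr z (\<chi> i. 1 / \<nu> k $ i)) \<partial>Q k)" for k x
    have J_meas[measurable]: "J k \<in> borel_measurable M" for k
      unfolding J_def by measurable
    have J_bound: "\<bar>J k x\<bar> \<le> B" for k x
    proof -
      have "\<bar>J k x\<bar> \<le> (\<integral>z. B \<partial>Q k)"
        unfolding J_def real_norm_def[symmetric]
        by (rule order_trans[OF integral_norm_bound integral_mono])
           (use B in \<open>auto intro!: Q.integrable_const_bound[where B = B]\<close>)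
      then show ?thesis using Q.prob_space[of k] by simp
    qed
    have "(\<integral>y. f y \<partial>Ms k) = (\<integral>x. J k x \<partial>M)" for k
    proof -
      have "(\<integral>y. f y \<partial>Ms k) = (\<integral>y. f (vpowr y (\<chi> i. 1 / \<nu> k $ i)) \<partial>N k)"
        unfolding Ms_def by (rule integral_distr) (auto simp: N_def)
      also have "\<dots> = (\<integral>x. \<integral>z. f (vpowr (c k x * z) (\<chi> i. 1 / \<nu> k $ i)) \<partial>Q k \<partial>M)"
        unfolding N_def by (rule orthant_law_times(2)[OF M Q' c c_nonneg, where B = B]) (auto simp: B)
      also have "\<dots> = (\<integral>x. J k x \<partial>M)"
      proof (rule Bochner_Integration.integral_cong[OF refl])
        fix x
        show "(\<integral>z. f (vpowr (c k x * z) (\<chi> i. 1 / \<nu> k $ i)) \<partial>Q k) = J k x"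
          unfolding J_def
        proof (rule integral_cong_AE)
          have "AE z in Q k. nonneg_vec z" using Q'[of k] by (simp add: orthant_law_def)
          then show "AE z in Q k. f (vpowr (c k x * z) (\<chi> i. 1 / \<nu> k $ i)) =
              f (d k x * vpowr z (\<chi> i. 1 / \<nu> k $ i))"
            by eventually_elim
               (simp add: vpowr_times c_nonneg, simp add: c_def vpowr_inverse_exponent d_nonneg \<nu>)
        qed measurable
      qed
      finally show ?thesis .
    qed
    moreover have "(\<lambda>k. \<integral>x. J k x \<partial>M) \<longlonglongrightarrow> (\<integral>x. f x \<partial>M)"
    proof (rule integral_dominated_convergence[where w = "\<lambda>_. B"])
      have "AE x in M. nonneg_vec x" using M by (simp add: orthant_law_def)
      then show "AE x in M. (\<lambda>k. J k x) \<longlonglongrightarrow> f x"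
      proof eventually_elim
        case (elim x)
        show ?case
          unfolding J_def
          by (rule integral_scaled_tendsto[where B = B])
             (use f B conc d_lim[OF elim] Q.prob_space_axioms in auto)
      qed
    qed (auto simp: J_bound)
    ultimately show "(\<lambda>k. \<integral>x. f x \<partial>Ms k) \<longlonglongrightarrow> (\<integral>x. f x \<partial>M)" by simp
  qed
  ultimately show ?thesis by blast
qed

section \<open>Erlang laws on the diagonal\<close>

text \<open>
  The sum of \<open>k + 1\<close> independent exponential variables, with the rate that makes the mean equal to one.
\<close>
definition erlang_law :: "nat \<Rightarrow> real measure" where
  "erlang_law k = density lborel (erlang_density k (real (Suc k)))"

lemma prob_space_erlang_law: "prob_space (erlang_law k)"
  unfolding erlang_law_def by (rule prob_space_erlang_density) simp

lemma sets_erlang_law [simp, measurable_cong]: "sets (erlang_law k) = sets borel"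
  by (simp add: erlang_law_def)

lemma space_erlang_law [simp]: "space (erlang_law k) = UNIV"
  by (simp add: erlang_law_def)

lemma erlang_law_nonneg: "AE t in erlang_law k. 0 \<le> t"
  unfolding erlang_law_def by (subst AE_density) (auto simp: erlang_density_def)

text \<open>
  Multiplying an Erlang density by an exponential gives, up to a factor, an Erlang density with a
  larger rate.
\<close>
lemma erlang_law_laplace:
  assumes v: "0 \<le> v"
  shows "(\<integral>t. exp (- (v * t)) \<partial>erlang_law k) = (1 / (1 + v / real (Suc k))) ^ Suc k"
proof -
  define l where "l = real (Suc k)"
  have l: "0 < l" by (simp add: l_def)
  interpret D: prob_space "density lborel (erlang_density k (l + v))"
    using l v by (intro prob_space_erlang_density) auto
  have total: "(\<integral>t. erlang_density k (l + v) t \<partial>lborel) = 1"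
  proof -
    have "(\<integral>t. 1 \<partial>density lborel (erlang_density k (l + v))) =
        (\<integral>t. erlang_density k (l + v) t *\<^sub>R (1::real) \<partial>lborel)"
      using l v by (subst integral_density) auto
    then show ?thesis using D.prob_space by simp
  qed
  have "(\<integral>t. exp (- (v * t)) \<partial>erlang_law k) =
      (\<integral>t. erlang_density k l t *\<^sub>R exp (- (v * t)) \<partial>lborel)"
    unfolding erlang_law_def l_def[symmetric] using l by (subst integral_density) auto
  also have "\<dots> = (\<integral>t. (l / (l + v)) ^ Suc k * erlang_density k (l + v) t \<partial>lborel)"
  proof (rule Bochner_Integration.integral_cong[OF refl])
    fix t
    have pow: "(l / (l + v)) ^ Suc k * (l + v) ^ Suc k = l ^ Suc k"
      using l v by (simp only: power_mult_distrib[symmetric]) simp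
    have exp: "exp (- l * t) * exp (- (v * t)) = exp (- (l + v) * t)"
      by (simp add: exp_add[symmetric] algebra_simps)
    show "erlang_density k l t *\<^sub>R exp (- (v * t)) =
        (l / (l + v)) ^ Suc k * erlang_density k (l + v) t"
    proof (cases "t < 0")
      case False
      then have "erlang_density k l t *\<^sub>R exp (- (v * t)) =
          l ^ Suc k * t ^ k * (exp (- l * t) * exp (- (v * t))) / fact k"
        by (simp only: erlang_density_def if_False real_scaleR_def mult.assoc times_divide_eq_left)
      also have "\<dots> = (l / (l + v)) ^ Suc k * erlang_density k (l + v) t"
        using False
        by (simp only: erlang_density_def if_False exp pow[symmetric] mult.assoc times_divide_eq_right)
      finally show ?thesis .
    qed (simp add: erlang_density_def)
  qed
  also have "\<dots> = (l / (l + v)) ^ Suc k"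
    using total by simp
  also have "l / (l + v) = 1 / (1 + v / l)"
    using l v by (simp add: field_simps)
  finally show ?thesis by (simp only: l_def)
qed

lemma erlang_law_concentration:
  assumes \<epsilon>: "0 < \<epsilon>"
  shows "measure (erlang_law k) {t. \<epsilon> \<le> \<bar>t - 1\<bar>} \<le> 1 / (real (Suc k) * \<epsilon>\<^sup>2)"
proof -
  interpret prob_space "erlang_law k" by (rule prob_space_erlang_law)
  have D: "distributed (erlang_law k) lborel (\<lambda>t. t) (erlang_density k (real (Suc k)))"
    unfolding distributed_def
    using distr_id2[of lborel "erlang_law k"]
    by (auto simp: erlang_law_def)
  have l: "0 < real (Suc k)" by simp
  have "expectation (\<lambda>t. t) = 1"
    using erlang_ith_moment[OF l D, of 1] by (simp del: of_nat_Suc)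
  moreover have "variance (\<lambda>t. t) = 1 / real (Suc k)"
    using erlang_distributed_variance[OF l D] by (simp add: power2_eq_square)
  moreover have "integrable (erlang_law k) (\<lambda>t. t\<^sup>2)"
    using erlang_ith_moment_integrable[OF l D, of 2] .
  ultimately show ?thesis
    using Chebyshev_inequality[of "\<lambda>t. t" \<epsilon>] \<epsilon> by simp
qed

definition diagonal_erlang_law :: "nat \<Rightarrow> (real^'n) measure" where
  "diagonal_erlang_law k = distr (erlang_law k) borel (\<lambda>t. t *\<^sub>R 1)"

lemma chain_law_diagonal_erlang:
  "chain_law 1 (Suc k) (\<lambda>_. (1 / real (Suc k)) *\<^sub>R 1) (diagonal_erlang_law k :: (real^'n) measure)"
  unfolding chain_law_def
proof (intro conjI allI impI)
  show "orthant_law (diagonal_erlang_law k :: (real^'n) measure)"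
    unfolding diagonal_erlang_law_def
    using erlang_law_nonneg[of k]
    by (intro orthant_law_distr prob_space_erlang_law) (auto simp: nonneg_vec_def)
  fix u :: "real^'n" assume u: "nonneg_vec u"
  define v where "v = u \<bullet> 1"
  have v: "0 \<le> v" using u unfolding v_def by (intro inner_nonneg_vec) (auto simp: nonneg_vec_def)
  have [simp]: "vpowr u 1 = u" using u by (simp add: vpowr_def nonneg_vec_def Finite_Cartesian_Product.vec_eq_iff)
  have "(\<integral>z. exp (- (u \<bullet> z)) \<partial>diagonal_erlang_law k) = (\<integral>t. exp (- (v * t)) \<partial>erlang_law k)"
    unfolding diagonal_erlang_law_def by (subst integral_distr) (auto simp: v_def mult.commute)
  also have "\<dots> = (1 / (1 + v / real (Suc k))) ^ Suc k" by (rule erlang_law_laplace[OF v])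
  also have "\<dots> = (\<Prod>l<Suc k. 1 / (1 + ((1 / real (Suc k)) *\<^sub>R 1) \<bullet> vpowr u 1))"
    by (simp add: v_def inner_commute[of 1])
  finally show "(\<integral>z. exp (- (u \<bullet> z)) \<partial>diagonal_erlang_law k) =
    (\<Prod>l<Suc k. 1 / (1 + ((1 / real (Suc k)) *\<^sub>R 1) \<bullet> vpowr u 1))" .
qed (auto simp: nonneg_vec_def)

text \<open>
  Chebyshev's inequality for the Erlang variable, transported through the power function, which is
  continuous at \<open>1\<close>.
\<close>
lemma diagonal_erlang_law_concentration:
  fixes \<gamma> :: "real^'n"
  assumes \<epsilon>: "0 < \<epsilon>"
  shows "(\<lambda>k. measure (diagonal_erlang_law k) {z. \<epsilon> \<le> dist (vpowr z \<gamma>) 1}) \<longlonglongrightarrow> 0"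
proof -
  have "((\<lambda>t. vpowr (t *\<^sub>R 1) \<gamma>) \<longlongrightarrow> (\<chi> i. 1 powr \<gamma> $ i)) (at 1)"
    unfolding vpowr_def by (intro tendsto_vec_lambda) (auto intro!: tendsto_eq_intros)
  then have "eventually (\<lambda>t. dist (vpowr (t *\<^sub>R 1) \<gamma>) 1 < \<epsilon>) (at 1)"
    using \<epsilon> by (auto dest!: tendstoD simp: one_vec_def)
  then obtain \<delta> where \<delta>: "0 < \<delta>" "\<And>t. t \<noteq> 1 \<Longrightarrow> dist t 1 < \<delta> \<Longrightarrow> dist (vpowr (t *\<^sub>R 1) \<gamma>) 1 < \<epsilon>"
    unfolding eventually_at by auto
  have "vpowr 1 \<gamma> = 1" by (simp add: vpowr_def Finite_Cartesian_Product.vec_eq_iff)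
  then have \<delta>': "\<delta> \<le> \<bar>t - 1\<bar>" if "\<epsilon> \<le> dist (vpowr (t *\<^sub>R 1) \<gamma>) 1" for t
    using \<delta>(2)[of t] that \<epsilon> by (cases "t = 1") (auto simp: dist_real_def not_less[symmetric])
  have bound: "measure (diagonal_erlang_law k) {z. \<epsilon> \<le> dist (vpowr z \<gamma>) 1} \<le> 1 / (real (Suc k) * \<delta>\<^sup>2)" for k
  proof -
    interpret prob_space "erlang_law k" by (rule prob_space_erlang_law)
    have "measure (diagonal_erlang_law k) {z. \<epsilon> \<le> dist (vpowr z \<gamma>) 1} =
        prob {t. \<epsilon> \<le> dist (vpowr (t *\<^sub>R 1) \<gamma>) 1}"
      unfolding diagonal_erlang_law_def by (subst measure_distr) auto
    also have "\<dots> \<le> prob {t. \<delta> \<le> \<bar>t - 1\<bar>}"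
      by (rule finite_measure_mono) (use \<delta>' in auto)
    also note erlang_law_concentration[OF \<delta>(1)]
    finally show ?thesis .
  qed
  have lim: "(\<lambda>k. 1 / (real (Suc k) * \<delta>\<^sup>2)) \<longlonglongrightarrow> 0"
    using \<delta>(1) by real_asymp
  show ?thesis
    by (rule tendsto_sandwich[OF _ _ tendsto_const lim])
       (intro always_eventually allI bound measure_nonneg)+
qed

section \<open>Vectors with independent Mittag-Leffler coordinates\<close>

lemma independent_coordinates_law:
  fixes \<mu> :: "'n::finite \<Rightarrow> real measure"
  assumes \<mu>: "\<And>i. real_distribution (\<mu> i)" "\<And>i. AE x in \<mu> i. 0 < x"
  obtains Q :: "(real^'n) measure" where "orthant_law Q" "AE z in Q. pos_vec z"
    "\<And>u. nonneg_vec u \<Longrightarrow> (\<integral>z. exp (- (u \<bullet> z)) \<partial>Q) = (\<Prod>i\<in>UNIV. \<integral>x. exp (- (u $ i) * x) \<partial>\<mu> i)"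
proof
  interpret \<mu>: real_distribution "\<mu> i" for i by (rule \<mu>)
  interpret P: product_prob_space \<mu> UNIV ..
  let ?P = "PiM UNIV \<mu>"
  have meas[measurable]: "(\<lambda>x. \<chi> i. x i) \<in> borel_measurable ?P"
    by (rule borel_measurable_vec_lambdaI) measurable
  have pos: "AE x in ?P. \<forall>i\<in>UNIV. 0 < x i"
    by (intro AE_finite_allI AE_PiM_component) (auto simp: \<mu>(2) \<mu>.prob_space_axioms)
  show "orthant_law (distr ?P borel (\<lambda>x. \<chi> i. x i))"
  proof (intro orthant_law_distr P.prob_space_axioms meas)
    show "AE x in ?P. nonneg_vec (\<chi> i. x i)"
      using pos by eventually_elim (simp add: nonneg_vec_def less_imp_le)
  qed
  have [measurable]: "Measurable.pred borel (pos_vec :: real^'n \<Rightarrow> bool)"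
    unfolding pos_vec_def by measurable
  show "AE z in distr ?P borel (\<lambda>x. \<chi> i. x i). pos_vec z"
    using pos by (subst AE_distr_iff) (auto simp: pos_vec_def[abs_def])
  fix u :: "real^'n" assume u: "nonneg_vec u"
  have split: "exp (- (u \<bullet> z)) = (\<Prod>i\<in>UNIV. exp (- (u $ i) * z $ i))" for z
    by (subst exp_sum[symmetric]) (simp_all add: inner_vec_def sum_negf)
  have "(\<integral>z. exp (- (u \<bullet> z)) \<partial>distr ?P borel (\<lambda>x. \<chi> i. x i)) =
      (\<integral>x. exp (- (u \<bullet> (\<chi> i. x i))) \<partial>?P)"
    by (rule integral_distr[OF meas]) simp
  also have "\<dots> = (\<integral>x. (\<Prod>i\<in>UNIV. exp (- (u $ i) * x i)) \<partial>?P)"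
    by (simp only: split vec_lambda_beta)
  also have "\<dots> = (\<Prod>i\<in>UNIV. \<integral>x. exp (- (u $ i) * x) \<partial>\<mu> i)"
  proof (rule P.product_integral_prod)
    fix i
    have "AE x in \<mu> i. norm (exp (- (u $ i) * x)) \<le> 1"
      using \<mu>(2)[of i] by eventually_elim (use u in \<open>simp add: nonneg_vec_def\<close>)
    then show "integrable (\<mu> i) (\<lambda>x. exp (- (u $ i) * x))"
      by (rule \<mu>.integrable_const_bound) simp
  qed simp
  finally show "(\<integral>z. exp (- (u \<bullet> z)) \<partial>distr ?P borel (\<lambda>x. \<chi> i. x i)) =
      (\<Prod>i\<in>UNIV. \<integral>x. exp (- (u $ i) * x) \<partial>\<mu> i)" .
qed

text \<open>
  The chain has one place per coordinate, with a reward only in that coordinate, so its transform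
  is a product of functions of one variable each; this is what independent coordinates produce.
\<close>
lemma mittag_leffler_chain_law:
  fixes \<alpha> :: "real^'n"
  assumes \<alpha>: "unit_exponents \<alpha>"
  obtains L s Q where "chain_law \<alpha> L s Q" "AE z in Q. pos_vec z"
proof -
  have "\<exists>M :: real measure. real_distribution M \<and> (AE x in M. 0 < x) \<and>
      (\<forall>u\<ge>0. (\<integral>x. exp (- u * x) \<partial>M) = 1 / (1 + u powr \<alpha> $ i))" for i
  proof -
    have "0 < \<alpha> $ i" "\<alpha> $ i \<le> 1" using \<alpha> by (auto simp: unit_exponents_def)
    then show ?thesis by (rule mittag_leffler_law) blast
  qed
  then obtain \<mu> where \<mu>: "\<And>i. real_distribution (\<mu> i)" "\<And>i. AE x in \<mu> i. 0 < x"
    and laplace: "\<And>i u. 0 \<le> u \<Longrightarrow> (\<integral>x. exp (- u * x) \<partial>\<mu> i) = 1 / (1 + u powr \<alpha> $ i)"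
    by metis
  obtain Q :: "(real^'n) measure" where Q: "orthant_law Q" "AE z in Q. pos_vec z"
    "\<And>u. nonneg_vec u \<Longrightarrow> (\<integral>z. exp (- (u \<bullet> z)) \<partial>Q) = (\<Prod>i\<in>UNIV. \<integral>x. exp (- (u $ i) * x) \<partial>\<mu> i)"
    by (rule independent_coordinates_law[of \<mu>]; (rule \<mu> | (rule that; assumption)))
  obtain e where e: "bij_betw e {..<CARD('n)} (UNIV :: 'n set)"
    using ex_bij_betw_nat_finite[of "UNIV :: 'n set"] by (auto simp: atLeast0LessThan)
  have "chain_law \<alpha> CARD('n) (\<lambda>l. axis (e l) 1) Q"
    unfolding chain_law_def
  proof (intro conjI allI impI Q(1))
    fix u :: "real^'n" assume u: "nonneg_vec u"
    have "(\<integral>z. exp (- (u \<bullet> z)) \<partial>Q) = (\<Prod>i\<in>UNIV. 1 / (1 + vpowr u \<alpha> $ i))"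
      unfolding Q(3)[OF u]
    proof (rule prod.cong[OF refl])
      fix i
      show "(\<integral>x. exp (- (u $ i) * x) \<partial>\<mu> i) = 1 / (1 + vpowr u \<alpha> $ i)"
        using laplace[of "u $ i" i] u by (simp add: nonneg_vec_def vpowr_def)
    qed
    also have "\<dots> = (\<Prod>l<CARD('n). 1 / (1 + vpowr u \<alpha> $ e l))"
      by (rule prod.reindex_bij_betw[OF e, symmetric])
    finally show "(\<integral>z. exp (- (u \<bullet> z)) \<partial>Q) = (\<Prod>l<CARD('n). 1 / (1 + axis (e l) 1 \<bullet> vpowr u \<alpha>))"
      by (simp add: inner_axis')
  qed (auto simp: nonneg_vec_def axis_def)
  then show ?thesis using Q(2) that by blast
qed

text \<open>
  Roots of increasing order of a positive number tend to one, so the convergence is almost sure, and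
  by dominated convergence it holds in probability.
\<close>
lemma roots_concentration:
  fixes Q :: "(real^'n) measure"
  assumes Q: "orthant_law Q" "AE z in Q. pos_vec z" and \<epsilon>: "0 < \<epsilon>"
  shows "(\<lambda>k. measure Q {z. \<epsilon> \<le> dist (vpowr z (\<chi> i. 1 / real (Suc k))) 1}) \<longlonglongrightarrow> 0"
proof -
  interpret prob_space Q using Q by (simp add: orthant_law_def)
  have [measurable_cong]: "sets Q = sets borel" and [simp]: "space Q = UNIV"
    using Q sets_eq_imp_space_eq[of Q borel] by (auto simp: orthant_law_def)
  define A where "A k = {z :: real^'n. \<epsilon> \<le> dist (vpowr z (\<chi> i. 1 / real (Suc k))) 1}" for k
  have A: "A k \<in> sets Q" for k
  proof -
    have "{z \<in> space Q. \<epsilon> \<le> dist (vpowr z (\<chi> i. 1 / real (Suc k))) 1} \<in> sets Q" by measurable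
    then show ?thesis by (simp add: A_def)
  qed
  have "(\<lambda>k. \<integral>z. indicator (A k) z \<partial>Q) \<longlonglongrightarrow> (\<integral>z. (0::real) \<partial>Q)"
  proof (rule integral_dominated_convergence[where w = "\<lambda>_. 1"])
    show "AE z in Q. (\<lambda>k. indicator (A k) z :: real) \<longlonglongrightarrow> 0"
      using Q(2)
    proof eventually_elim
      case (elim z)
      have "(\<lambda>k. vpowr z (\<chi> i. 1 / real (Suc k))) \<longlonglongrightarrow> (\<chi> i. 1)"
        unfolding vpowr_def
      proof (intro tendsto_vec_lambda)
        fix i
        have "0 < z $ i" using elim by (simp add: pos_vec_def)
        then show "(\<lambda>k. z $ i powr (\<chi> i. 1 / real (Suc k)) $ i) \<longlonglongrightarrow> 1"
          by simp real_asymp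
      qed
      then have "eventually (\<lambda>k. dist (vpowr z (\<chi> i. 1 / real (Suc k))) 1 < \<epsilon>) sequentially"
        using \<epsilon> by (auto dest!: tendstoD simp: one_vec_def)
      then have "eventually (\<lambda>k. indicator (A k) z = (0 :: real)) sequentially"
        by eventually_elim (simp add: A_def)
      then show ?case by (rule tendsto_eventually)
    qed
  qed (use A in \<open>auto split: split_indicator\<close>)
  moreover have "(\<integral>z. indicator (A k) z \<partial>Q) = measure Q (A k)" for k
    using A[of k] by simp
  ultimately show ?thesis by (simp add: A_def)
qed

section \<open>The three dense classes\<close>

lemma orthant_law_GMML_pow:
  assumes "is_GMML_pow \<nu> \<alpha> p \<pi> T R N"
  shows "orthant_law N"
proof -
  obtain M where M: "orthant_law M" "N = distr M borel (\<lambda>x. vpowr x (\<chi> i. 1 / \<nu> $ i))"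
    using assms by (auto simp: is_GMML_pow_def is_GMML_def)
  then have [measurable_cong]: "sets M = sets borel" by (simp add: orthant_law_def)
  show ?thesis
    unfolding M(2) using M(1) by (intro orthant_law_distr) (auto simp: orthant_law_def nonneg_vec_vpowr)
qed

text \<open>
  The power function with exponents one is the identity only on the orthant, whence the argument with
  almost sure equality.
\<close>
lemma is_GMML_pow_1:
  assumes "is_GMML_pow 1 \<alpha> p \<pi> T R N"
  shows "is_GMML \<alpha> p \<pi> T R N"
proof -
  obtain M where M: "is_GMML \<alpha> p \<pi> T R M" "N = distr M borel (\<lambda>x. vpowr x (\<chi> i. 1 / 1 $ i))"
    using assms by (auto simp: is_GMML_pow_def)
  have [measurable_cong]: "sets M = sets borel" and nn: "AE x in M. nonneg_vec x"
    using M(1) by (auto simp: is_GMML_def orthant_law_def)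
  have "N = distr M borel (\<lambda>x. x)"
    unfolding M(2)
  proof (rule distr_cong_AE)
    show "AE x in M. vpowr x (\<chi> i. 1 / 1 $ i) = x"
      using nn by eventually_elim
        (simp add: nonneg_vec_def vpowr_def Finite_Cartesian_Product.vec_eq_iff)
  qed auto
  also have "\<dots> = M" by (rule distr_id2) (simp add: \<open>sets M = sets borel\<close>)
  finally show ?thesis using M(1) by simp
qed

theorem theorem7:
  shows "dense_on_orthant
           {M :: (real^'n) measure.
              \<exists>\<alpha> p \<pi> T R. unit_exponents \<alpha> \<and> reward_rep p \<pi> T R \<and> is_GMML \<alpha> p \<pi> T R M}
         \<and> (\<forall>\<alpha> :: real^'n. unit_exponents \<alpha> \<longrightarrow>
           dense_on_orthant
             {M. \<exists>\<nu> p \<pi> T R. pos_vec \<nu> \<and> reward_rep p \<pi> T R \<and> is_GMML_pow \<nu> \<alpha> p \<pi> T R M})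
         \<and> (\<forall>\<gamma> :: real^'n. pos_vec \<gamma> \<longrightarrow>
           dense_on_orthant
             {M. \<exists>\<alpha> \<nu> p \<pi> T R. unit_exponents \<alpha> \<and> pos_vec \<nu> \<and>
                   (\<forall>i. \<alpha> $ i * \<nu> $ i = inverse (\<gamma> $ i)) \<and>
                   reward_rep p \<pi> T R \<and> is_GMML_pow \<nu> \<alpha> p \<pi> T R M})"
proof (intro conjI allI impI)
  have approx_1: "\<exists>Ms. (\<forall>k. \<exists>p \<pi> T R. reward_rep p \<pi> T R \<and> is_GMML_pow \<nu> 1 p \<pi> T R (Ms k)) \<and>
      weak_conv_to Ms M" if "pos_vec \<nu>" "orthant_law M" for \<nu> :: "real^'n" and M
    by (rule GMML_pow_approximation[OF that(1) chain_law_diagonal_erlang _ that(2)])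
       (rule diagonal_erlang_law_concentration)
  have unit_1: "unit_exponents (1 :: real^'n)" by (simp add: unit_exponents_def)
  show "dense_on_orthant {M :: (real^'n) measure.
      \<exists>\<alpha> p \<pi> T R. unit_exponents \<alpha> \<and> reward_rep p \<pi> T R \<and> is_GMML \<alpha> p \<pi> T R M}"
    unfolding dense_on_orthant_def
  proof (intro conjI allI impI)
    fix M :: "(real^'n) measure" assume "orthant_law M"
    then obtain Ms where Ms: "\<And>k. \<exists>p \<pi> T R. reward_rep p \<pi> T R \<and> is_GMML_pow 1 1 p \<pi> T R (Ms k)"
      and w: "weak_conv_to Ms M"
      using approx_1[of 1 M] by (auto simp: pos_vec_def)
    have "Ms k \<in> {M. \<exists>\<alpha> p \<pi> T R. unit_exponents \<alpha> \<and> reward_rep p \<pi> T R \<and> is_GMML \<alpha> p \<pi> T R M}" for k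
      using Ms[of k] unit_1 is_GMML_pow_1 by blast
    with w show "\<exists>Ms. (\<forall>k. Ms k \<in> {M. \<exists>\<alpha> p \<pi> T R. unit_exponents \<alpha> \<and> reward_rep p \<pi> T R \<and>
        is_GMML \<alpha> p \<pi> T R M}) \<and> weak_conv_to Ms M"
      by blast
  qed (auto simp: is_GMML_def)
  show "dense_on_orthant
      {M. \<exists>\<nu> p \<pi> T R. pos_vec \<nu> \<and> reward_rep p \<pi> T R \<and> is_GMML_pow \<nu> \<alpha> p \<pi> T R M}"
    if \<alpha>: "unit_exponents \<alpha>" for \<alpha> :: "real^'n"
    unfolding dense_on_orthant_def
  proof (intro conjI allI impI)
    fix M :: "(real^'n) measure" assume M: "orthant_law M"
    obtain L s Q where Q: "chain_law \<alpha> L s Q" "AE z in Q. pos_vec z"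
      by (rule mittag_leffler_chain_law[OF \<alpha>])
    define \<nu> :: "nat \<Rightarrow> real^'n" where "\<nu> k = (\<chi> i. real (Suc k))" for k
    have \<nu>: "pos_vec (\<nu> k)" for k by (simp add: \<nu>_def pos_vec_def)
    have "(\<lambda>k. measure Q {z. \<epsilon> \<le> dist (vpowr z (\<chi> i. 1 / \<nu> k $ i)) 1}) \<longlonglongrightarrow> 0"
      if "0 < \<epsilon>" for \<epsilon>
      using roots_concentration[OF _ Q(2) that] Q(1) by (simp add: \<nu>_def chain_law_def)
    from GMML_pow_approximation[OF \<nu> Q(1) this M]
    show "\<exists>Ms. (\<forall>k. Ms k \<in> {M. \<exists>\<nu> p \<pi> T R. pos_vec \<nu> \<and> reward_rep p \<pi> T R \<and>
        is_GMML_pow \<nu> \<alpha> p \<pi> T R M}) \<and> weak_conv_to Ms M"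
      using \<nu> by blast
  qed (auto simp: orthant_law_GMML_pow)
  show "dense_on_orthant {M. \<exists>\<alpha> \<nu> p \<pi> T R. unit_exponents \<alpha> \<and> pos_vec \<nu> \<and>
      (\<forall>i. \<alpha> $ i * \<nu> $ i = inverse (\<gamma> $ i)) \<and> reward_rep p \<pi> T R \<and> is_GMML_pow \<nu> \<alpha> p \<pi> T R M}"
    if \<gamma>: "pos_vec \<gamma>" for \<gamma> :: "real^'n"
    unfolding dense_on_orthant_def
  proof (intro conjI allI impI)
    fix M :: "(real^'n) measure" assume M: "orthant_law M"
    define \<nu> :: "real^'n" where "\<nu> = (\<chi> i. inverse (\<gamma> $ i))"
    have \<nu>: "pos_vec \<nu>" "\<forall>i. (1 :: real^'n) $ i * \<nu> $ i = inverse (\<gamma> $ i)"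
      using \<gamma> by (auto simp: \<nu>_def pos_vec_def)
    show "\<exists>Ms. (\<forall>k. Ms k \<in> {M. \<exists>\<alpha> \<nu> p \<pi> T R. unit_exponents \<alpha> \<and> pos_vec \<nu> \<and>
      (\<forall>i. \<alpha> $ i * \<nu> $ i = inverse (\<gamma> $ i)) \<and> reward_rep p \<pi> T R \<and> is_GMML_pow \<nu> \<alpha> p \<pi> T R M}) \<and>
      weak_conv_to Ms M"
    proof -
      obtain Ms where Ms: "\<And>k. \<exists>p \<pi> T R. reward_rep p \<pi> T R \<and> is_GMML_pow \<nu> 1 p \<pi> T R (Ms k)"
        and w: "weak_conv_to Ms M"
        using approx_1[OF \<nu>(1) M] by auto
      have "Ms k \<in> {M. \<exists>\<alpha> \<nu> p \<pi> T R. unit_exponents \<alpha> \<and> pos_vec \<nu> \<and>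
          (\<forall>i. \<alpha> $ i * \<nu> $ i = inverse (\<gamma> $ i)) \<and> reward_rep p \<pi> T R \<and>
          is_GMML_pow \<nu> \<alpha> p \<pi> T R M}" for k
        using Ms[of k] \<nu> unit_1 by (intro CollectI) metis
      with w show ?thesis by blast
    qed
  qed (auto simp: orthant_law_GMML_pow)
qed

end
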